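(* For each positive integer $n$ let $p=p(n)$ be a positive integer with $p(n)\le n$, and let $X_1,\dots,X_{n+1}$ be i.i.d. random vectors with distribution $\mathcal{N}_p(\mu,\Sigma)$, where $\mu\in\mathbb{R}^p$ and $\Sigma$ is a $p\times p$ positive definite matrix ($p$, $\mu$, $\Sigma$ may depend on $n$). Let $\hat\Sigma$ be the sample covariance matrix. If $\lim_{n\to\infty}\frac{p(n)}{n}=r$ for some $0\le r<1$, then, as $n\to\infty$, $$\frac{\log\det\hat\Sigma-\sum_{k=1}^p\log\left(1-\frac kn\right)-\log\det\Sigma}{\sqrt{-2\log\left(1-\frac pn\right)}}\ \longrightarrow\ \mathcal{N}(0,1)\quad\text{in distribution.}$$
   Context: The sample covariance matrix is $\hat\Sigma=\frac1n\sum_{k=1}^{n+1}(X_k-\bar X)(X_k-\bar X)^T$, where $\bar X=\frac{1}{n+1}\sum_{k=1}^{n+1}X_k$. Since $r<1$, one has $p(n)<n$ for all large $n$, so the displayed quantity is defined for all large $n$. *)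

theory Defs
  imports
    "HOL-Probability.Probability"
    "Jordan_Normal_Form.Gauss_Jordan_Elimination"
    "Jordan_Normal_Form.Determinant"
begin

unbundle no vec_syntax

hide_const (open) Determinants.det Finite_Cartesian_Product.vec Finite_Cartesian_Product.mat

definition positive_definite_mat :: "nat \<Rightarrow> real mat \<Rightarrow> bool" where
  "positive_definite_mat p A \<longleftrightarrow>
     A \<in> carrier_mat p p \<and> transpose_mat A = A \<and>
     (\<forall>v \<in> carrier_vec p. v \<noteq> 0\<^sub>v p \<longrightarrow> v \<bullet> (A *\<^sub>v v) > 0)"

(* Since the dimension depends on n, random p-vectors are functions nat => real living on the
   product space PiM {..<p}, with coordinates indexed from 0; "vec p x" is the corresponding
   element of carrier_vec p. *)

definition multivariate_normal_density :: "nat \<Rightarrow> real vec \<Rightarrow> real mat \<Rightarrow> (nat \<Rightarrow> real) \<Rightarrow> real" where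
  "multivariate_normal_density p \<mu> \<Sigma> x =
     exp (- ((vec p x - \<mu>) \<bullet> (the (mat_inverse \<Sigma>) *\<^sub>v (vec p x - \<mu>))) / 2)
       / sqrt ((2 * pi) ^ p * det \<Sigma>)"

definition multivariate_normal_distributed ::
  "'a measure \<Rightarrow> nat \<Rightarrow> ('a \<Rightarrow> nat \<Rightarrow> real) \<Rightarrow> real vec \<Rightarrow> real mat \<Rightarrow> bool" where
  "multivariate_normal_distributed M p X \<mu> \<Sigma> \<longleftrightarrow>
     distributed M (PiM {..<p} (\<lambda>_. lborel)) X
       (\<lambda>x. ennreal (multivariate_normal_density p \<mu> \<Sigma> x))"

definition sample_mean :: "nat \<Rightarrow> (nat \<Rightarrow> nat \<Rightarrow> real) \<Rightarrow> nat \<Rightarrow> real" where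
  "sample_mean n x i = (\<Sum>k=1..n+1. x k i) / real (n + 1)"

(* The sample has size n + 1; the normalization is by n. *)
definition sample_covariance :: "nat \<Rightarrow> nat \<Rightarrow> (nat \<Rightarrow> nat \<Rightarrow> real) \<Rightarrow> real mat" where
  "sample_covariance n p x =
     mat p p (\<lambda>(i, j). (1 / real n) *
       (\<Sum>k=1..n+1. (x k i - sample_mean n x i) * (x k j - sample_mean n x j)))"

end

theory Submission
  imports Defs
begin

text \<open>
  The log-determinant has the law of a sum of independent terms.  Write the sample as
  \<open>X\<^sub>k = \<mu> + L Z\<^sub>k\<close> with \<open>\<Sigma> = L L\<^sup>T\<close> and standard Gaussian \<open>Z\<^sub>k\<close>.  Then the determinant of the sample
  covariance matrix is \<open>n\<^sup>-\<^sup>p D\<^sub>p det \<Sigma>\<close>, where \<open>D\<^sub>p\<close> is the Gram determinant of the \<open>p\<close> centered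
  coordinate columns of the array \<open>Z\<close>, which are vectors of length \<open>n + 1\<close>.  Adding a column multiplies the Gram determinant
  by the squared distance of the new raw column to the span of the old ones and the constant vector.
  Given the old columns, this squared distance is chi-square distributed with \<open>n - j\<close> degrees of freedom,
  whatever the old columns are, as long as they are nondegenerate.  So integrating out one column at a time
  shows that the mean of \<open>exp (is ln D\<^sub>p)\<close>, for real \<open>s\<close>, is the product over \<open>j < p\<close> of
  \<open>exp (is ln 2) \<Gamma>((n - j) / 2 + is) / \<Gamma>((n - j) / 2)\<close>.

  The asymptotic part is a second-order expansion of \<open>ln \<Gamma>\<close> along vertical lines.  For \<open>a = m / 2\<close>,
  \<open>ln \<Gamma>(a + is) - ln \<Gamma>(a) = is \<psi>(a) - s\<^sup>2 \<psi>'(a) / 2 + O(|s|\<^sup>3 / a\<^sup>2)\<close>, and up to \<open>O(1 / a\<^sup>2)\<close>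
  one may replace \<open>\<psi>(a)\<close> by \<open>ln (a - 1/2)\<close> and \<open>\<psi>'(a)\<close> by \<open>2 (ln a - ln (a - 1/2))\<close>.  With these
  replacements the centering \<open>\<Sum> ln (1 - k / n)\<close> of the theorem cancels exactly, the variances telescope
  to exactly \<open>-2 ln (1 - p / n)\<close>, and only the errors remain.  There are \<open>p\<close> of them, each
  \<open>O(n\<^sup>-\<^sup>2)\<close> times a cubic polynomial in \<open>|s| \<le> |t| sqrt (n / p)\<close>, so their sum is \<open>O(n\<^sup>-\<^sup>1\<^sup>/\<^sup>2)\<close>
  uniformly in \<open>p\<close>; this covers the cases \<open>r = 0\<close> and bounded \<open>p\<close> without separate treatment.
  Levy's continuity theorem then gives the claim.

  The chi-square law of the squared distance (lemma \<open>residual_square_gamma\<close>) is obtained without rotating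
  coordinates: its Laplace transform follows from Fubini's theorem after every factor \<open>exp (t v\<^sup>2 / 2)\<close>
  is written as the Gaussian mean of \<open>exp (sqrt t g v)\<close>, and the values of the Laplace
  transform at the natural numbers are the moments of a bounded variable.
  The lemmas that carry the proof are \<open>gamma_product_expansion\<close>,
  \<open>residual_square_log_char\<close>, \<open>det_gram_mat_step\<close>, \<open>gram_det_log_char\<close> and \<open>log_det_char\<close>.
\<close>

section \<open>The Gamma function along vertical lines\<close>

text \<open>
  The terms are dominated by the telescoping differences of \<open>2 / (a + k)\<^sup>2\<close>.
\<close>

lemma sum_inverse_cube_bound:
  fixes a :: real assumes a: "a \<ge> 1"
  shows "summable (\<lambda>k. 1 / (a + real k) ^ 3)" "(\<Sum>k. 1 / (a + real k) ^ 3) \<le> 2 / a^2"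
proof -
  define f where "f k = 2 / (a + real k)^2" for k
  have lim: "f \<longlonglongrightarrow> 0" unfolding f_def by real_asymp
  have s: "(\<lambda>k. f k - f (Suc k)) sums (2 / a^2)"
    using telescope_sums'[OF lim] by (simp add: f_def)
  have le: "1 / (a + real k) ^ 3 \<le> f k - f (Suc k)" for k
  proof -
    define x where "x = a + real k"
    have x: "x \<ge> 1" using a by (simp add: x_def)
    have "f k - f (Suc k) - 1 / x^3 = (2*x*(2*x+1) - (x+1)^2) / (x^3 * (x+1)^2)"
      using x unfolding f_def by (simp add: x_def[symmetric] add.assoc[symmetric] divide_simps) (simp add: x_def power2_eq_square power3_eq_cube algebra_simps)
    moreover have "2*x*(2*x+1) - (x+1)^2 \<ge> 0"
      using x mult_mono[OF x x] by (simp add: power2_eq_square algebra_simps)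
    ultimately have "f k - f (Suc k) - 1 / x^3 \<ge> 0" using x by (simp add: zero_le_divide_iff)
    then show ?thesis by (simp add: x_def)
  qed
  show sm: "summable (\<lambda>k. 1 / (a + real k) ^ 3)"
    by (rule summable_comparison_test'[OF sums_summable[OF s], of 0]) (use le a in simp)
  show "(\<Sum>k. 1 / (a + real k) ^ 3) \<le> 2 / a^2"
    using suminf_le[OF le sm sums_summable[OF s]] sums_unique[OF s] by simp
qed

lemma norm_Polygamma_2_bound:
  fixes z :: complex assumes "Re z \<ge> a" "a \<ge> 1"
  shows "norm (Polygamma 2 z) \<le> 4 / a^2"
proof -
  have z: "z \<noteq> 0" using assms by auto
  have le: "norm (inverse ((z + of_nat k)^3)) \<le> 1 / (a + real k)^3" for k
  proof -
    have "a + real k \<le> norm (z + of_nat k)" using assms complex_Re_le_cmod[of "z + of_nat k"] by simp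
    then have "(a + real k)^3 \<le> norm (z + of_nat k)^3" using assms by (intro power_mono) auto
    then have "inverse (norm (z + of_nat k)^3) \<le> inverse ((a + real k)^3)"
      using assms by (intro le_imp_inverse_le) auto
    then show ?thesis by (simp only: norm_inverse norm_power divide_inverse mult_1_left)
  qed
  note sm = sum_inverse_cube_bound[OF assms(2)]
  have sm': "summable (\<lambda>k. norm (inverse ((z + of_nat k)^3)))"
    by (rule summable_comparison_test'[OF sm(1), of 0]) (use le in auto)
  have "norm (Polygamma 2 z) = 2 * norm (\<Sum>k. inverse ((z + of_nat k)^3))"
    by (simp add: Polygamma_def norm_mult norm_power eval_nat_numeral)
  also have "\<dots> \<le> 2 * (\<Sum>k. norm (inverse ((z + of_nat k)^3)))"
    using summable_norm[OF sm'] by simp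
  also have "\<dots> \<le> 2 * (\<Sum>k. 1 / (a + real k)^3)"
    using suminf_le[OF le sm' sm(1)] by simp
  also have "\<dots> \<le> 4 / a^2" using sm(2) by simp
  finally show ?thesis .
qed

text \<open>
  Comparison of \<open>\<Sum> 1 / (a + k)\<^sup>2\<close> with the telescoping sum of
  \<open>1 / ((a + k) (a + k + 1))\<close>; the two terms differ by at most \<open>1 / (a + k)\<^sup>3\<close>.
\<close>

lemma Trigamma_approx:
  fixes a :: real assumes a: "a \<ge> 1"
  shows "\<bar>Polygamma 1 a - 1 / a\<bar> \<le> 2 / a^2"
proof -
  define f where "f k = 1 / (a + real k)" for k
  have lim: "f \<longlonglongrightarrow> 0" unfolding f_def by real_asymp
  have s: "(\<lambda>k. f k - f (Suc k)) sums (1 / a)"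
    using telescope_sums'[OF lim] by (simp add: f_def)
  have sp: "summable (\<lambda>k. inverse ((a + real k)^2))"
    using Polygamma_converges'[of a 2] a by simp
  note sm = sum_inverse_cube_bound[OF a]
  have b: "0 \<le> inverse ((a + real k)^2) - (f k - f (Suc k))"
    "inverse ((a + real k)^2) - (f k - f (Suc k)) \<le> 1 / (a + real k)^3" for k
  proof -
    define x where "x = a + real k"
    have x: "x \<ge> 1" using a by (simp add: x_def)
    have e: "inverse (x^2) - (f k - f (Suc k)) = 1 / (x^2 * (x+1))"
      using x unfolding f_def by (simp add: x_def[symmetric] add.assoc[symmetric] divide_simps) (simp add: x_def power2_eq_square power3_eq_cube algebra_simps)
    show "0 \<le> inverse ((a + real k)^2) - (f k - f (Suc k))"
      using e x by (simp add: x_def)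
    have "1 / (x^2 * (x+1)) \<le> 1 / (x^2 * x)" using x by (intro divide_left_mono mult_left_mono) auto
    then show "inverse ((a + real k)^2) - (f k - f (Suc k)) \<le> 1 / (a + real k)^3"
      using e by (simp add: x_def power3_eq_cube power2_eq_square)
  qed
  have sd: "summable (\<lambda>k. inverse ((a + real k)^2) - (f k - f (Suc k)))"
    by (rule summable_diff[OF sp sums_summable[OF s]])
  have "Polygamma 1 a = (\<Sum>k. inverse ((a + real k)^2))"
    by (simp add: Polygamma_def power2_eq_square)
  then have "Polygamma 1 a - 1/a = (\<Sum>k. inverse ((a + real k)^2) - (f k - f (Suc k)))"
    by (simp only: suminf_diff[OF sp sums_summable[OF s], symmetric] sums_unique[OF s, symmetric])
  moreover have "0 \<le> (\<Sum>k. inverse ((a + real k)^2) - (f k - f (Suc k)))"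
    using b(1) by (intro suminf_nonneg sd)
  moreover have "(\<Sum>k. inverse ((a + real k)^2) - (f k - f (Suc k))) \<le> 2 / a^2"
    using suminf_le[OF b(2) sd sm(1)] sm(2) by simp
  ultimately show ?thesis by simp
qed

lemma ln_central_difference_bound:
  fixes x :: real assumes x: "x \<ge> 1"
  shows "\<bar>ln (x + 1/2) - ln (x - 1/2) - 1 / x\<bar> \<le> 1 / (8 * x^3)"
proof -
  define y where "y = 1 / (2*x)"
  have y: "0 < y" "y \<le> 1/2" using x by (auto simp: y_def field_simps)
  define f where "f u = ln (1 + u) - ln (1 - u) - 2 * u" for u :: real
  have d: "(f has_real_derivative (2 * u^2 / (1 - u^2))) (at u)" if "0 \<le> u" "u \<le> 1/2" for u
  proof -
    have "1 - u^2 = (1+u)*(1-u)" by (simp add: power2_eq_square algebra_simps)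
    then show ?thesis unfolding f_def using that
      by (auto intro!: derivative_eq_intros simp: field_simps power2_eq_square)
  qed
  have u2: "u^2 \<le> 1/4" if "0 \<le> u" "u \<le> 1/2" for u :: real
    using power_mono[of u "1/2" 2] that by (simp add: power2_eq_square)
  have "f 0 \<le> f y"
  proof (rule DERIV_nonneg_imp_nondecreasing[of 0 y f])
    fix u assume u: "0 \<le> u" "u \<le> y"
    have "2 * u^2 / (1 - u^2) \<ge> 0" using u2[of u] u y by (intro divide_nonneg_nonneg) auto
    then show "\<exists>y. (f has_real_derivative y) (at u) \<and> 0 \<le> y" using d[of u] u y by auto
  qed (use y in auto)
  moreover have "y^3 - f y \<ge> 0^3 - f 0"
  proof (rule DERIV_nonneg_imp_nondecreasing[of 0 y "\<lambda>u. u^3 - f u"])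
    fix u assume u: "0 \<le> u" "u \<le> y"
    have "((\<lambda>u. u^3 - f u) has_real_derivative (3*u^2 - 2 * u^2 / (1 - u^2))) (at u)"
      using u y by (auto intro!: derivative_eq_intros d)
    moreover have "3*u^2 - 2 * u^2 / (1 - u^2) \<ge> 0"
    proof -
      have *: "1 - u^2 \<ge> 3/4" using u2[of u] u y by simp
      then have "2 / (1 - u^2) \<le> 3" by (simp add: field_simps)
      then have "u^2 * (2 / (1 - u^2)) \<le> u^2 * 3" by (intro mult_left_mono) auto
      then show ?thesis by (simp add: mult.commute)
    qed
    ultimately show "\<exists>y. ((\<lambda>u. u^3 - f u) has_real_derivative y) (at u) \<and> 0 \<le> y" by blast
  qed (use y in auto)
  ultimately have "\<bar>f y\<bar> \<le> y^3" by (simp add: f_def)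
  moreover have "f y = ln (x + 1/2) - ln (x - 1/2) - 1 / x"
  proof -
    have "x + 1/2 = x * (1 + y)" "x - 1/2 = x * (1 - y)" using x by (auto simp: y_def field_simps)
    then have "ln (x + 1/2) = ln x + ln (1 + y)" "ln (x - 1/2) = ln x + ln (1 - y)"
      using x y by (simp_all add: ln_mult_pos)
    then show ?thesis by (simp add: f_def y_def)
  qed
  ultimately show ?thesis by (simp add: y_def power_divide power_mult_distrib)
qed

text \<open>
  The shift by \<open>1/2\<close> makes the approximation second-order accurate: \<open>1 / x\<close> differs from the
  central difference \<open>ln (x + 1/2) - ln (x - 1/2)\<close> only by \<open>O(1 / x\<^sup>3)\<close>, and summing this over
  \<open>x = a + k\<close> turns the defining limit of the digamma function into \<open>ln (a - 1/2)\<close>.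
\<close>

lemma Digamma_approx:
  fixes a :: real assumes a: "a \<ge> 1"
  shows "\<bar>Digamma a - ln (a - 1/2)\<bar> \<le> 1 / (4 * a^2)"
proof -
  define e where "e k = ln (a + real k + 1/2) - ln (a + real k - 1/2) - 1 / (a + real k)" for k
  have e: "\<bar>e k\<bar> \<le> (1 / 8) * (1 / (a + real k)^3)" for k
    using ln_central_difference_bound[of "a + real k"] a by (simp add: e_def)
  note sm = sum_inverse_cube_bound[OF a]
  have tele: "(\<Sum>k<m. e k) = ln (a + real m - 1/2) - ln (a - 1/2) - (\<Sum>k<m. inverse (a + of_nat k))" for m
    by (induction m) (auto simp: e_def inverse_eq_divide algebra_simps)
  have "(\<lambda>m. (ln (real m) - (\<Sum>k<m. inverse (a + of_nat k))) + (ln (a + real m - 1/2) - ln (real m)) - ln (a-1/2)) \<longlonglongrightarrow> Digamma a + 0 - ln (a-1/2)"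
    by (intro tendsto_intros, use Digamma_LIMSEQ[of a] a in simp) (real_asymp)
  then have lim: "(\<lambda>m. \<Sum>k<m. e k) \<longlonglongrightarrow> Digamma a - ln (a-1/2)"
    unfolding tele by (simp add: algebra_simps)
  have bd: "\<bar>\<Sum>k<m. e k\<bar> \<le> 1 / (4 * a^2)" for m
  proof -
    have "\<bar>\<Sum>k<m. e k\<bar> \<le> (\<Sum>k<m. (1 / 8) * (1 / (a + real k)^3))"
      by (intro sum_abs[THEN order_trans] sum_mono e)
    also have "\<dots> = (1/8) * (\<Sum>k<m. 1 / (a + real k)^3)" by (simp add: sum_distrib_left)
    also have "\<dots> \<le> (1/8) * (\<Sum>k. 1 / (a + real k)^3)"
      using a by (intro mult_left_mono sum_le_suminf sm) auto
    also have "\<dots> \<le> (1/8) * (2 / a^2)" using sm(2) by (intro mult_left_mono) auto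
    finally show ?thesis by simp
  qed
  show ?thesis
    by (rule LIMSEQ_le_const2[OF tendsto_rabs[OF lim]]) (use bd in auto)
qed

lemma ln_Gamma_vertical_Taylor:
  fixes a s :: real assumes a: "a \<ge> 1"
  shows "norm (ln_Gamma (Complex a s) - ln_Gamma (complex_of_real a)
            - (\<i> * complex_of_real (s * Digamma a) - complex_of_real (s^2 / 2 * Polygamma 1 a))) \<le> 2 * \<bar>s\<bar>^3 / a^2"
proof -
  define f :: "nat \<Rightarrow> complex \<Rightarrow> complex" where "f i = (case i of 0 \<Rightarrow> ln_Gamma | Suc k \<Rightarrow> Polygamma k)" for i
  have np: "x \<notin> \<int>\<^sub>\<le>\<^sub>0" if "a \<le> Re x" for x :: complex
    using that a by (auto elim!: nonpos_Ints_cases)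
  have cv: "convex {x. a \<le> Re x}"
    using convex_halfspace_Re_ge[of a] by (simp add: convex_halfspace_Re_ge)
  have der: "(f i has_field_derivative f (Suc i) x) (at x within {x. a \<le> Re x})" if "x \<in> {x. a \<le> Re x}" "i \<le> 2" for i x
  proof (cases i)
    case 0
    have "x \<notin> \<real>\<^sub>\<le>\<^sub>0" using that a by (auto simp: complex_nonpos_Reals_iff)
    then show ?thesis
      using has_field_derivative_at_within[OF has_field_derivative_ln_Gamma_complex] by (simp add: f_def 0)
  next
    case (Suc k)
    then show ?thesis unfolding f_def using that np[of x]
      by (auto intro!: has_field_derivative_Polygamma)
  qed
  have main: "norm (f 0 (Complex a s) - (\<Sum>i\<le>2. f i (of_real a) * (Complex a s - of_real a) ^ i / fact i))
      \<le> 4 / a^2 * norm (Complex a s - of_real a) ^ Suc 2 / fact 2"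
  proof (rule complex_Taylor[where f = f and n = 2, OF cv])
    fix i x assume "x \<in> {x. a \<le> Re x}" "i \<le> (2::nat)"
    then show "(f i has_field_derivative f (Suc i) x) (at x within {x. a \<le> Re x})" by (rule der)
  next
    fix x assume "x \<in> {x. a \<le> Re x}"
    then show "norm (f (Suc 2) x) \<le> 4 / a^2"
      using norm_Polygamma_2_bound[of a x] a by (simp add: f_def)
  qed auto
  have d: "Complex a s - of_real a = \<i> * s" by (simp add: complex_eq_iff)
  have e: "(\<Sum>i\<le>2. f i (of_real a) * (\<i> * s) ^ i / fact i) =
     ln_Gamma (complex_of_real a) + (\<i> * complex_of_real (s * Digamma a) - complex_of_real (s^2 / 2 * Polygamma 1 a))"
    using a by (simp add: eval_nat_numeral f_def Polygamma_of_real algebra_simps)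
  have b: "4 / a^2 * norm (\<i> * s) ^ Suc 2 / fact 2 = 2 * \<bar>s\<bar>^3 / a^2"
    by (simp add: norm_mult eval_nat_numeral)
  have f0: "f 0 = ln_Gamma" by (simp add: f_def)
  show ?thesis using main unfolding d e b f0 by (simp only: diff_diff_eq)
qed

text \<open>
  For \<open>a = m / 2\<close> the two main terms involve only \<open>ln m\<close> and \<open>ln (m - 1)\<close>.  This is what makes the
  centering cancel and the variances telescope in the product over \<open>m\<close>.
\<close>

lemma Gamma_ratio_expansion:
  fixes a s :: real assumes a: "a \<ge> 1"
  obtains R where "Gamma (Complex a s) / Gamma (of_real a) = exp (\<i> * complex_of_real (s * ln (a - 1/2)) - complex_of_real (s^2 * (ln a - ln (a - 1/2))) + R)"
    "norm R \<le> (\<bar>s\<bar> + 2 * s^2 + 2 * \<bar>s\<bar>^3) / a^2"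
proof -
  define T where "T = ln_Gamma (Complex a s) - ln_Gamma (complex_of_real a)
            - (\<i> * complex_of_real (s * Digamma a) - complex_of_real (s^2 / 2 * Polygamma 1 a))"
  define D where "D = Digamma a - ln (a - 1/2)"
  define V where "V = Polygamma 1 a - 2 * (ln a - ln (a - 1/2))"
  define R where "R = T + (\<i> * complex_of_real (s * D) - complex_of_real (s^2 / 2 * V))"
  have np: "x \<notin> \<int>\<^sub>\<le>\<^sub>0" if "a \<le> Re x" for x :: complex
    using that a by (auto elim!: nonpos_Ints_cases)
  have "Gamma (Complex a s) / Gamma (of_real a) = exp (ln_Gamma (Complex a s) - ln_Gamma (complex_of_real a))"
    using np[of "Complex a s"] np[of "of_real a"] by (simp add: Gamma_complex_altdef exp_diff)
  also have "ln_Gamma (Complex a s) - ln_Gamma (complex_of_real a) = \<i> * complex_of_real (s * ln (a - 1/2)) - complex_of_real (s^2 * (ln a - ln (a - 1/2))) + R"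
    by (simp add: R_def T_def D_def V_def field_simps)
  finally have 1: "Gamma (Complex a s) / Gamma (of_real a) = exp (\<i> * complex_of_real (s * ln (a - 1/2)) - complex_of_real (s^2 * (ln a - ln (a - 1/2))) + R)" .
  have T: "norm T \<le> 2 * \<bar>s\<bar>^3 / a^2" unfolding T_def by (rule ln_Gamma_vertical_Taylor[OF a])
  have D: "\<bar>D\<bar> \<le> 1 / a^2"
    using Digamma_approx[OF a] a unfolding D_def by (rule_tac order_trans) (auto simp: field_simps)
  have V: "\<bar>V\<bar> \<le> 4 / a^2"
  proof -
    have "ln (a - 1/2) = ln a + ln (1 + (- 1/(2*a)))"
    proof -
      have "a - 1/2 = a * (1 + (-1/(2*a)))" using a by (simp add: field_simps)
      moreover have "1 + (-1/(2*a)) > 0" using a by (simp add: field_simps)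
      ultimately show ?thesis using a using ln_mult_pos[of a "1 + (-1/(2*a))"] by simp
    qed
    moreover have "\<bar>ln (1 + (- 1/(2*a))) - (- 1/(2*a))\<bar> \<le> 2 * (- 1/(2*a))^2"
      using a by (intro abs_ln_one_plus_x_minus_x_bound) (auto simp: field_simps)
    ultimately have "\<bar>1 / a - 2 * (ln a - ln (a - 1/2))\<bar> \<le> 1 / a^2"
      by (simp add: power_divide power_mult_distrib)
    then have "\<bar>V\<bar> \<le> 2 / a^2 + 1 / a^2"
      using Trigamma_approx[OF a] unfolding V_def by linarith
    also have "\<dots> \<le> 4 / a^2" by (simp add: add_divide_distrib[symmetric] divide_right_mono)
    finally show ?thesis .
  qed
  have "norm R \<le> norm T + (\<bar>s\<bar> * \<bar>D\<bar> + s^2 / 2 * \<bar>V\<bar>)"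
    unfolding R_def
    by (intro norm_triangle_le add_left_mono norm_triangle_le_diff) (simp add: norm_mult norm_divide norm_power)
  also have "\<dots> \<le> 2 * \<bar>s\<bar>^3 / a^2 + (\<bar>s\<bar> * (1 / a^2) + s^2 / 2 * (4 / a^2))"
    by (intro add_mono mult_left_mono T D V) auto
  also have "\<dots> = (\<bar>s\<bar> + 2 * s^2 + 2 * \<bar>s\<bar>^3) / a^2" by (simp add: add_divide_distrib)
  finally show ?thesis using 1 that by blast
qed

text \<open>
  The degrees of freedom \<open>n - j\<close> stay above \<open>\<delta> n\<close>, so every factor contributes an error of order
  \<open>n\<^sup>-\<^sup>2\<close> times a cubic in \<open>|t| / \<sigma>\<close>.  The bound is uniform in \<open>p\<close> because \<open>\<sigma>\<^sup>2\<close> is at least \<open>p / n\<close>: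
  a small \<open>p\<close> makes the argument \<open>t / \<sigma>\<close> large, but there are then fewer factors.
\<close>

lemma gamma_product_expansion:
  fixes n p :: nat and t \<delta> :: real
  defines "\<sigma> \<equiv> sqrt (- 2 * ln (1 - real p / real n))"
  assumes p: "1 \<le> p" "p < n" and \<delta>: "\<delta> > 0" "\<delta> * real n \<le> real n - real p"
  obtains R where
    "iexp (- (t / \<sigma> * ((\<Sum>k=1..p. ln (1 - real k / real n)) + real p * ln (real n)))) *
       (\<Prod>j<p. iexp (t / \<sigma> * ln 2) * (Gamma (Complex (real (n - j) / 2) (t / \<sigma>)) / Gamma (of_real (real (n - j) / 2))))
     = exp (complex_of_real (- (t^2) / 2) + R)"
    "norm R \<le> 4 / \<delta>^2 * (\<bar>t\<bar> + 2 * t^2 + 2 * \<bar>t\<bar>^3) / sqrt (real n)"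
proof -
  define s where "s = t / \<sigma>"
  define a where "a j = real (n - j) / 2" for j
  define E where "E = \<bar>s\<bar> + 2 * s^2 + 2 * \<bar>s\<bar>^3"
  have n: "n > 0" using p by auto
  have a1: "a j \<ge> 1" if "j < p" for j using that p by (auto simp: a_def)
  have "\<exists>R. Gamma (Complex (a j) s) / Gamma (of_real (a j)) = exp (\<i> * complex_of_real (s * ln (a j - 1/2)) - complex_of_real (s^2 * (ln (a j) - ln (a j - 1/2))) + R)
     \<and> norm R \<le> E / (a j)^2" if "j < p" for j
    using Gamma_ratio_expansion[OF a1[OF that], of s] unfolding E_def by metis
  then obtain R where R: "\<And>j. j < p \<Longrightarrow> Gamma (Complex (a j) s) / Gamma (of_real (a j)) = exp (\<i> * complex_of_real (s * ln (a j - 1/2)) - complex_of_real (s^2 * (ln (a j) - ln (a j - 1/2))) + R j)"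
     "\<And>j. j < p \<Longrightarrow> norm (R j) \<le> E / (a j)^2" by metis
  have L1: "(\<Sum>j<p. ln 2 + ln (a j - 1/2)) = (\<Sum>k=1..p. ln (1 - real k / real n)) + real p * ln (real n)"
  proof -
    have "ln 2 + ln (a j - 1/2) = ln (1 - real (Suc j) / real n) + ln (real n)" if "j < p" for j
    proof -
      have "ln 2 + ln (a j - 1/2) = ln (2 * (a j - 1/2))" using a1[OF that] by (intro ln_mult_pos[symmetric]) auto
      also have "2 * (a j - 1/2) = (1 - real (Suc j) / real n) * real n" using n p that by (simp add: a_def field_simps)
      also have "ln \<dots> = ln (1 - real (Suc j) / real n) + ln (real n)" using n p that by (intro ln_mult_pos) auto
      finally show ?thesis .
    qed
    then have "(\<Sum>j<p. ln 2 + ln (a j - 1/2)) = (\<Sum>j<p. ln (1 - real (Suc j) / real n) + ln (real n))" by simp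
    also have "\<dots> = (\<Sum>j<p. ln (1 - real (Suc j) / real n)) + real p * ln (real n)" by (simp add: sum.distrib)
    also have "(\<Sum>j<p. ln (1 - real (Suc j) / real n)) = (\<Sum>k=1..p. ln (1 - real k / real n))"
      by (rule sum.reindex_bij_witness[of _ "\<lambda>k. k - 1" Suc]) auto
    finally show ?thesis .
  qed
  have tele: "(\<Sum>j<m. ln (a j) - ln (a j - 1/2)) = - ln (1 - real m / real n)" if "m \<le> p" for m
    using that
  proof (induction m)
    case (Suc m)
    have "ln (a m) - ln (a m - 1/2) = ln (1 - real m / real n) - ln (1 - real (Suc m) / real n)"
    proof -
      have "a m = (1 - real m / real n) * (n / 2)" "a m - 1/2 = (1 - real (Suc m) / real n) * (n / 2)"
        using n p Suc.prems by (simp_all add: a_def field_simps)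
      then have "ln (a m) = ln (1 - real m / real n) + ln (real n / 2)" "ln (a m - 1/2) = ln (1 - real (Suc m) / real n) + ln (real n / 2)"
        using n p Suc.prems by (simp_all only:) (intro ln_mult_pos; simp)+
      then show ?thesis by simp
    qed
    then show ?case using Suc by simp
  qed (simp)
  define q where "q = real p / real n"
  have q: "0 < q" "q < 1" using p by (auto simp: q_def)
  have lnq: "q \<le> - ln (1 - q)" using ln_le_minus_one[of "1 - q"] q by simp
  have \<sigma>2: "\<sigma>^2 = - 2 * ln (1 - q)" using lnq q unfolding \<sigma>_def q_def[symmetric] by (subst real_sqrt_pow2) auto
  have \<sigma>0: "\<sigma> > 0" using lnq q unfolding \<sigma>_def q_def[symmetric] by simp
  have L2: "s^2 * (\<Sum>j<p. ln (a j) - ln (a j - 1/2)) = t^2 / 2"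
  proof -
    have S: "(\<Sum>j<p. ln (a j) - ln (a j - 1/2)) = \<sigma>^2 / 2"
      unfolding tele[OF order_refl] \<sigma>2 by (simp add: q_def)
    show ?thesis unfolding S using \<sigma>0 by (simp add: s_def power_divide)
  qed
  define RR where "RR = (\<Sum>j<p. R j)"
  have "(\<Prod>j<p. iexp (s * ln 2) * (Gamma (Complex (a j) s) / Gamma (of_real (a j))))
      = (\<Prod>j<p. exp (\<i> * complex_of_real (s * (ln 2 + ln (a j - 1/2))) - complex_of_real (s^2 * (ln (a j) - ln (a j - 1/2))) + R j))"
    by (intro prod.cong refl) (simp add: R(1) exp_add[symmetric] algebra_simps)
  also have "\<dots> = exp (\<Sum>j<p. \<i> * complex_of_real (s * (ln 2 + ln (a j - 1/2))) - complex_of_real (s^2 * (ln (a j) - ln (a j - 1/2))) + R j)"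
    by (simp add: exp_sum)
  also have "(\<Sum>j<p. \<i> * complex_of_real (s * (ln 2 + ln (a j - 1/2))) - complex_of_real (s^2 * (ln (a j) - ln (a j - 1/2))) + R j)
     = \<i> * complex_of_real (s * (\<Sum>j<p. ln 2 + ln (a j - 1/2))) - of_real (s^2 * (\<Sum>j<p. ln (a j) - ln (a j - 1/2))) + RR"
  proof -
    have "(\<Sum>j<p. \<i> * complex_of_real (s * f j) - complex_of_real (s^2 * g j) + R j)
        = \<i> * complex_of_real (s * (\<Sum>j<p. f j)) - of_real (s^2 * (\<Sum>j<p. g j)) + RR" for f g :: "nat \<Rightarrow> real"
      by (simp add: RR_def sum.distrib sum_subtractf sum_distrib_left)
    then show ?thesis .
  qed
  finally have main: "iexp (- (s * ((\<Sum>k=1..p. ln (1 - real k / real n)) + real p * ln (real n)))) *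
       (\<Prod>j<p. iexp (s * ln 2) * (Gamma (Complex (a j) s) / Gamma (of_real (a j))))
     = exp (complex_of_real (- (t^2) / 2) + RR)"
    unfolding L1 L2 by (simp add: exp_add[symmetric] exp_diff exp_minus field_simps)
  \<comment> \<open>As w is at least 1, all powers of the argument t / \<sigma> up to the third are bounded by one multiple of w^3.\<close>
  define w where "w = sqrt (real n / real p)"
  have w: "w \<ge> 1" using p by (simp add: w_def)
  have sw: "\<bar>s\<bar> \<le> \<bar>t\<bar> * w"
  proof -
    have "(1 / w)^2 \<le> \<sigma>^2" using lnq q unfolding \<sigma>2 by (simp add: w_def power_divide q_def[symmetric])
    then have "1 / w \<le> \<sigma>" by (rule power2_le_imp_le) (use \<sigma>0 in simp)
    then have "1 / \<sigma> \<le> w" using \<sigma>0 w by (simp add: field_simps)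
    then have "\<bar>t\<bar> * (1 / \<sigma>) \<le> \<bar>t\<bar> * w" by (intro mult_left_mono) auto
    moreover have "\<bar>s\<bar> = \<bar>t\<bar> * (1 / \<sigma>)" using \<sigma>0 by (simp add: s_def abs_divide)
    ultimately show ?thesis by (simp only:)
  qed
  have w3: "w \<le> w^3" "w^2 \<le> w^3" using w by (auto intro: power_increasing[of 1 3 w, simplified] power_increasing)
  have E: "E \<le> (\<bar>t\<bar> + 2 * t^2 + 2 * \<bar>t\<bar>^3) * w^3"
  proof -
    have "\<bar>s\<bar> \<le> \<bar>t\<bar> * w^3" using sw mult_left_mono[OF w3(1), of "\<bar>t\<bar>"] by simp
    moreover have "s^2 \<le> t^2 * w^3"
      using power_mono[OF sw, of 2] mult_left_mono[OF w3(2), of "t^2"] by (simp add: power_mult_distrib)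
    moreover have "\<bar>s\<bar>^3 \<le> \<bar>t\<bar>^3 * w^3"
      using power_mono[OF sw, of 3] by (simp add: power_mult_distrib)
    ultimately show ?thesis unfolding E_def by (simp add: algebra_simps)
  qed
  have E0: "E \<ge> 0" by (simp add: E_def)
  have "norm RR \<le> (\<Sum>j<p. norm (R j))" unfolding RR_def by (rule norm_sum)
  also have "\<dots> \<le> (\<Sum>j<p. E * (4 / (\<delta>^2 * real n^2)))"
  proof (rule sum_mono)
    fix j assume "j \<in> {..<p}" then have j: "j < p" by simp
    have "\<delta> * real n / 2 \<le> a j" using \<delta> j p by (simp add: a_def)
    then have "(\<delta> * real n / 2)^2 \<le> (a j)^2" using \<delta> by (intro power_mono) auto
    then have "E / (a j)^2 \<le> E / (\<delta> * real n / 2)^2" using E0 \<delta> n a1[OF j] by (intro divide_left_mono) auto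
    then show "norm (R j) \<le> E * (4 / (\<delta>^2 * real n^2))" using R(2)[OF j] by (simp add: power_divide power_mult_distrib)
  qed
  also have "\<dots> = E * (4 / \<delta>^2 * (real p / real n^2))" by simp
  also have "\<dots> \<le> ((\<bar>t\<bar> + 2 * t^2 + 2 * \<bar>t\<bar>^3) * w^3) * (4 / \<delta>^2 * (real p / real n^2))"
    by (intro mult_right_mono E) simp
  also have "\<dots> = 4 / \<delta>^2 * (\<bar>t\<bar> + 2 * t^2 + 2 * \<bar>t\<bar>^3) * (w * (w^2 * (real p / real n^2)))"
    by (simp add: eval_nat_numeral)
  also have "w^2 * (real p / real n^2) = 1 / real n"
    using n p by (simp add: w_def field_simps power2_eq_square)
  also have "4 / \<delta>^2 * (\<bar>t\<bar> + 2 * t^2 + 2 * \<bar>t\<bar>^3) * (w * (1 / real n)) \<le> 4 / \<delta>^2 * (\<bar>t\<bar> + 2 * t^2 + 2 * \<bar>t\<bar>^3) * (1 / sqrt n)"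
  proof (rule mult_left_mono)
    have "w \<le> sqrt n" using p by (simp add: w_def field_simps)
    then have "w / real n \<le> sqrt n / real n" using n by (intro divide_right_mono) auto
    also have "\<dots> = 1 / sqrt n" using n by (simp add: field_simps)
    finally show "w * (1 / real n) \<le> 1 / sqrt n" by simp
  qed auto
  finally have "norm RR \<le> 4 / \<delta>^2 * (\<bar>t\<bar> + 2 * t^2 + 2 * \<bar>t\<bar>^3) / sqrt n" by simp
  with main show ?thesis using that unfolding s_def a_def by blast
qed

lemma gamma_product_tendsto:
  fixes p :: "nat \<Rightarrow> nat" and t r :: real
  defines "\<sigma> \<equiv> \<lambda>n. sqrt (- 2 * ln (1 - real (p n) / real n))"
  assumes p: "\<And>n. n \<ge> 1 \<Longrightarrow> 1 \<le> p n" and r: "r < 1" and ratio: "(\<lambda>n. real (p n) / real n) \<longlonglongrightarrow> r"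
  shows "(\<lambda>n. iexp (- (t / \<sigma> n * ((\<Sum>k=1..p n. ln (1 - real k / real n)) + real (p n) * ln (real n)))) *
       (\<Prod>j<p n. iexp (t / \<sigma> n * ln 2) * (Gamma (Complex (real (n - j) / 2) (t / \<sigma> n)) / Gamma (of_real (real (n - j) / 2)))))
     \<longlonglongrightarrow> exp (- complex_of_real (t^2 / 2))" (is "?f \<longlonglongrightarrow> _")
proof -
  define \<delta> where "\<delta> = (1 - r) / 2"
  have \<delta>: "\<delta> > 0" using r by (simp add: \<delta>_def)
  define B where "B n = 4 / \<delta>^2 * (\<bar>t\<bar> + 2 * t^2 + 2 * \<bar>t\<bar>^3) / sqrt (real n)" for n
  have "\<forall>\<^sub>F n in sequentially. real (p n) / real n < 1 - \<delta>"
    by (rule order_tendstoD[OF ratio]) (use r in \<open>simp add: \<delta>_def field_simps\<close>)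
  then have ev: "\<forall>\<^sub>F n in sequentially. \<exists>R. ?f n = exp (complex_of_real (- (t^2) / 2) + R) \<and> norm R \<le> B n"
    using eventually_gt_at_top[of 0]
  proof eventually_elim
    case (elim n)
    then have *: "\<delta> * real n \<le> real n - real (p n)" by (simp add: field_simps)
    moreover have "0 < \<delta> * real n" using elim \<delta> by simp
    ultimately have pn: "p n < n" by linarith
    have p1: "1 \<le> p n" using p[of n] elim by simp
    show ?case unfolding \<sigma>_def B_def
      by (rule gamma_product_expansion[OF p1 pn \<delta> *, of t]) blast
  qed
  define R where "R n = (SOME R. ?f n = exp (complex_of_real (- (t^2) / 2) + R) \<and> norm R \<le> B n)" for n
  have evR: "\<forall>\<^sub>F n in sequentially. ?f n = exp (complex_of_real (- (t^2) / 2) + R n) \<and> norm (R n) \<le> B n"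
    using ev by eventually_elim (unfold R_def, rule someI_ex)
  have "B \<longlonglongrightarrow> 0" unfolding B_def by real_asymp
  then have "R \<longlonglongrightarrow> 0" by (rule Lim_null_comparison[rotated]) (use evR in eventually_elim, simp)
  then have "(\<lambda>n. exp (complex_of_real (- (t^2) / 2) + R n)) \<longlonglongrightarrow> exp (complex_of_real (- (t^2) / 2) + 0)" by (intro tendsto_intros)
  then have "?f \<longlonglongrightarrow> exp (complex_of_real (- (t^2) / 2) + 0)"
    by (rule Lim_transform_eventually) (use evR in eventually_elim, simp)
  then show ?thesis by simp
qed

section \<open>Distance of a Gaussian vector to a subspace\<close>

lemma nn_integral_std_normal_exp_quadratic:
  fixes \<alpha> \<beta> :: real assumes "\<alpha> < 1"
  shows "(\<integral>\<^sup>+ y. ennreal (exp (\<alpha> * y^2 / 2 + \<beta> * y)) \<partial>std_normal_distribution)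
      = ennreal (exp (\<beta>^2 / (2 * (1 - \<alpha>))) / sqrt (1 - \<alpha>))"
proof -
  define c where "c = 1 - \<alpha>"
  define s where "s = 1 / sqrt c"
  have c: "c > 0" "\<alpha> = 1 - c" using assms by (auto simp: c_def)
  have s: "s > 0" "s^2 = 1 / c" using c by (auto simp: s_def power_divide)
  have *: "std_normal_density y * exp (\<alpha> * y^2 / 2 + \<beta> * y) = (exp (\<beta>^2 / (2*c)) * s) * normal_density (\<beta>/c) s y" for y
  proof -
    have "-(y\<^sup>2)/2 + (\<alpha> * y^2 / 2 + \<beta> * y) = \<beta>^2 / (2*c) + (-(y-\<beta>/c)\<^sup>2/(2 * s\<^sup>2))"
      using c(1) unfolding s(2) c(2) by (simp add: field_simps power2_eq_square)
    then have "exp(-(y\<^sup>2)/2) * exp (\<alpha> * y^2 / 2 + \<beta> * y) = exp (\<beta>^2 / (2*c)) * exp (-(y-\<beta>/c)\<^sup>2/(2 * s\<^sup>2))"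
      by (simp only: exp_add[symmetric])
    then show ?thesis using s(1) unfolding normal_density_def by (simp add: real_sqrt_mult field_simps)
  qed
  have "(\<integral>\<^sup>+ y. ennreal (exp (\<alpha> * y^2 / 2 + \<beta> * y)) \<partial>std_normal_distribution) = (\<integral>\<^sup>+ y. ennreal (std_normal_density y * exp (\<alpha> * y^2 / 2 + \<beta> * y)) \<partial>lborel)"
    by (subst nn_integral_density) (auto simp: ennreal_mult intro!: nn_integral_cong)
  also have "\<dots> = (\<integral>\<^sup>+ y. ennreal (exp (\<beta>^2 / (2*c)) * s) * ennreal (normal_density (\<beta>/c) s y) \<partial>lborel)"
    unfolding * using s(1) by (simp add: ennreal_mult)
  also have "\<dots> = ennreal (exp (\<beta>^2 / (2*c)) * s) * (\<integral>\<^sup>+ y. ennreal (normal_density (\<beta>/c) s y) \<partial>lborel)"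
    by (rule nn_integral_cmult) auto
  also have "(\<integral>\<^sup>+ y. ennreal (normal_density (\<beta>/c) s y) \<partial>lborel) = 1"
    using prob_space.emeasure_space_1[OF prob_space_normal_density[OF s(1), of "\<beta>/c"]] by (simp add: emeasure_density)
  finally show ?thesis by (simp add: s_def c_def)
qed

lemma prob_space_std_normal: "prob_space std_normal_distribution"
  using real_dist_normal_dist by (simp add: real_distribution_def)

abbreviation std_gaussian :: "'i set \<Rightarrow> ('i \<Rightarrow> real) measure" where
  "std_gaussian J \<equiv> PiM J (\<lambda>_. std_normal_distribution)"

interpretation std_normal: prob_space std_normal_distribution by (rule prob_space_std_normal)

lemma product_sigma_finite_std_normal: "product_sigma_finite (\<lambda>_::'i. std_normal_distribution)"
  by (simp add: product_sigma_finite_def std_normal.sigma_finite_measure_axioms)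

lemma prob_space_std_gaussian: "prob_space (std_gaussian J)"
  by (intro prob_space_PiM prob_space_std_normal)

lemma sets_std_gaussian [measurable_cong]: "sets (std_gaussian J) = sets (PiM J (\<lambda>_. borel))"
  by (intro sets_PiM_cong) auto

text \<open>
  For orthonormal \<open>u\<close> this is the squared distance of \<open>y\<close> to the span of \<open>u 0, \<dots>, u (d - 1)\<close>.  This form,
  as a difference of squares of linear forms, is the one whose exponential factors.
\<close>

definition residual_square :: "'i set \<Rightarrow> nat \<Rightarrow> (nat \<Rightarrow> 'i \<Rightarrow> real) \<Rightarrow> ('i \<Rightarrow> real) \<Rightarrow> real" where
  "residual_square J d u y = (\<Sum>k\<in>J. (y k)^2) - (\<Sum>i<d. (\<Sum>k\<in>J. u i k * y k)^2)"

definition orthonormal_on :: "'i set \<Rightarrow> nat \<Rightarrow> (nat \<Rightarrow> 'i \<Rightarrow> real) \<Rightarrow> bool" where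
  "orthonormal_on J d u \<longleftrightarrow> (\<forall>i<d. \<forall>j<d. (\<Sum>k\<in>J. u i k * u j k) = (if i = j then 1 else 0))"

lemma sum_square_orthonormal_combination:
  assumes "orthonormal_on J d u"
  shows "(\<Sum>k\<in>J. (\<Sum>i<d. g i * u i k)^2) = (\<Sum>i<d. (g i)^2)"
proof -
  have "(\<Sum>k\<in>J. (\<Sum>i<d. g i * u i k)^2) = (\<Sum>k\<in>J. \<Sum>i<d. \<Sum>j<d. g i * g j * (u i k * u j k))"
    by (simp add: power2_eq_square sum_product algebra_simps)
  also have "\<dots> = (\<Sum>i<d. \<Sum>j<d. g i * g j * (\<Sum>k\<in>J. u i k * u j k))"
    by (subst sum.swap, intro sum.cong refl, subst sum.swap) (simp add: sum_distrib_left)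
  also have "\<dots> = (\<Sum>i<d. \<Sum>j<d. if i = j then g i * g j else 0)"
    using assms by (intro sum.cong refl) (simp add: orthonormal_on_def)
  also have "\<dots> = (\<Sum>i<d. (g i)^2)" by (simp add: power2_eq_square)
  finally show ?thesis .
qed

lemma residual_square_eq:
  assumes "orthonormal_on J d u"
  shows "residual_square J d u y = (\<Sum>k\<in>J. (y k - (\<Sum>i<d. (\<Sum>l\<in>J. u i l * y l) * u i k))^2)"
proof -
  define g where "g i = (\<Sum>l\<in>J. u i l * y l)" for i
  have "(\<Sum>k\<in>J. (y k - (\<Sum>i<d. g i * u i k))^2) =
     (\<Sum>k\<in>J. (y k)^2) - 2 * (\<Sum>k\<in>J. y k * (\<Sum>i<d. g i * u i k)) + (\<Sum>k\<in>J. (\<Sum>i<d. g i * u i k)^2)"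
    by (simp add: power2_diff sum.distrib sum_subtractf sum_distrib_left algebra_simps)
  also have "(\<Sum>k\<in>J. y k * (\<Sum>i<d. g i * u i k)) = (\<Sum>i<d. (g i)^2)"
    by (simp add: sum_distrib_left) (subst sum.swap, simp add: power2_eq_square g_def sum_distrib_left algebra_simps)
  finally show ?thesis unfolding sum_square_orthonormal_combination[OF assms]
    by (simp add: residual_square_def g_def)
qed

lemma residual_square_nonneg:
  assumes "orthonormal_on J d u" shows "residual_square J d u y \<ge> 0"
  unfolding residual_square_eq[OF assms] by (intro sum_nonneg) auto

lemma measurable_residual_square [measurable]:
  "residual_square J d u \<in> borel_measurable (PiM J (\<lambda>_. borel))"
  unfolding residual_square_def[abs_def] by measurable

text \<open>
  The squares of the linear forms \<open>v\<close> are linearized by \<open>exp (t v\<^sup>2 / 2) = E exp (sqrt t g v)\<close> with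
  auxiliary standard normal \<open>g\<close>.  After exchanging the two integrations the coordinates of \<open>y\<close>
  separate, and orthonormality turns the resulting quadratic form in \<open>g\<close> into \<open>\<Sum> g\<^sub>i\<^sup>2\<close>, so that the
  coordinates of \<open>g\<close> separate as well.
\<close>

lemma nn_integral_exp_residual_square:
  fixes t :: real and u :: "nat \<Rightarrow> 'i \<Rightarrow> real"
  assumes J: "finite J" and u: "orthonormal_on J d u" and t: "t \<ge> 0"
  shows "(\<integral>\<^sup>+ y. ennreal (exp (- t * (residual_square J d u y / 2))) \<partial>std_gaussian J)
     = ennreal ((1 / sqrt (1 + t)) ^ card J * (sqrt (1 + t)) ^ d)"
proof -
  interpret PJ: product_sigma_finite "\<lambda>_::'i. std_normal_distribution" by (rule product_sigma_finite_std_normal)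
  interpret PD: product_sigma_finite "\<lambda>_::nat. std_normal_distribution" by (rule product_sigma_finite_std_normal)
  interpret J: prob_space "std_gaussian J" by (rule prob_space_std_gaussian)
  interpret D: prob_space "std_gaussian {..<d}" by (rule prob_space_std_gaussian)
  interpret JD: pair_sigma_finite "std_gaussian J" "std_gaussian {..<d}" ..
  \<comment> \<open>The coupling constant for which the Gaussian mean of exp (c g v) is exp (t v^2 / 2).\<close>
  define c where "c = sqrt t"
  have c: "c^2 = t" using t by (simp add: c_def)
  have "(\<integral>\<^sup>+ y. ennreal (exp (- t * (residual_square J d u y / 2))) \<partial>std_gaussian J)
     = (\<integral>\<^sup>+ y. (\<integral>\<^sup>+ g. ennreal (exp (- t / 2 * (\<Sum>k\<in>J. (y k)^2) + (\<Sum>i<d. c * (\<Sum>k\<in>J. u i k * y k) * g i))) \<partial>std_gaussian {..<d}) \<partial>std_gaussian J)"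
  proof (rule nn_integral_cong)
    fix y :: "'i \<Rightarrow> real"
    have "(\<integral>\<^sup>+ g. ennreal (exp (- t / 2 * (\<Sum>k\<in>J. (y k)^2) + (\<Sum>i<d. c * (\<Sum>k\<in>J. u i k * y k) * g i))) \<partial>std_gaussian {..<d})
       = (\<integral>\<^sup>+ g. ennreal (exp (- t / 2 * (\<Sum>k\<in>J. (y k)^2))) * (\<Prod>i<d. ennreal (exp (c * (\<Sum>k\<in>J. u i k * y k) * g i))) \<partial>std_gaussian {..<d})"
      by (intro nn_integral_cong, simp only: exp_add exp_sum[OF finite_lessThan] prod_ennreal exp_ge_zero)
        (subst ennreal_mult, auto intro: prod_nonneg)
    also have "\<dots> = ennreal (exp (- t / 2 * (\<Sum>k\<in>J. (y k)^2))) * (\<Prod>i<d. \<integral>\<^sup>+ x. ennreal (exp (c * (\<Sum>k\<in>J. u i k * y k) * x)) \<partial>std_normal_distribution)"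
      by (subst nn_integral_cmult) (auto intro!: arg_cong2[where f="(*)"] PD.product_nn_integral_prod)
    also have "\<dots> = ennreal (exp (- t / 2 * (\<Sum>k\<in>J. (y k)^2))) * (\<Prod>i<d. ennreal (exp (t / 2 * (\<Sum>k\<in>J. u i k * y k)^2)))"
      using nn_integral_std_normal_exp_quadratic[of 0] c by (simp add: power_mult_distrib)
    also have "\<dots> = ennreal (exp (- t * (residual_square J d u y / 2)))"
      by (simp add: residual_square_def prod_ennreal exp_sum[symmetric] ennreal_mult[symmetric] exp_add[symmetric] sum_distrib_left diff_divide_distrib sum_divide_distrib sum_negf algebra_simps)
    finally show "ennreal (exp (- t * (residual_square J d u y / 2))) = (\<integral>\<^sup>+ g. ennreal (exp (- t / 2 * (\<Sum>k\<in>J. (y k)^2) + (\<Sum>i<d. c * (\<Sum>k\<in>J. u i k * y k) * g i))) \<partial>std_gaussian {..<d})" ..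
  qed
  also have "\<dots> = (\<integral>\<^sup>+ g. (\<integral>\<^sup>+ y. ennreal (exp (- t / 2 * (\<Sum>k\<in>J. (y k)^2) + (\<Sum>i<d. c * (\<Sum>k\<in>J. u i k * y k) * g i))) \<partial>std_gaussian J) \<partial>std_gaussian {..<d})"
    by (rule JD.Fubini'[symmetric]) measurable
  also have "\<dots> = (\<integral>\<^sup>+ g. ennreal ((1 / sqrt (1 + t)) ^ card J) * (\<Prod>i<d. ennreal (exp (t / (1 + t) * (g i)^2 / 2))) \<partial>std_gaussian {..<d})"
  proof (rule nn_integral_cong)
    fix g :: "nat \<Rightarrow> real"
    define w where "w k = (\<Sum>i<d. g i * u i k)" for k
    have "- t / 2 * (\<Sum>k\<in>J. (y k)^2) + (\<Sum>i<d. c * (\<Sum>k\<in>J. u i k * y k) * g i) = (\<Sum>k\<in>J. - t * (y k)^2 / 2 + c * w k * y k)" for y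
    proof -
      have "(\<Sum>i<d. c * (\<Sum>k\<in>J. u i k * y k) * g i) = (\<Sum>k\<in>J. c * w k * y k)"
        unfolding w_def sum_distrib_left sum_distrib_right
        by (subst sum.swap) (simp add: algebra_simps)
      then show ?thesis by (simp add: sum.distrib sum_subtractf sum_negf sum_distrib_left)
    qed
    then have "(\<integral>\<^sup>+ y. ennreal (exp (- t / 2 * (\<Sum>k\<in>J. (y k)^2) + (\<Sum>i<d. c * (\<Sum>k\<in>J. u i k * y k) * g i))) \<partial>std_gaussian J)
      = (\<integral>\<^sup>+ y. (\<Prod>k\<in>J. ennreal (exp (- t * (y k)^2 / 2 + c * w k * y k))) \<partial>std_gaussian J)"
      by (simp only: exp_sum[OF J] prod_ennreal exp_ge_zero)
    also have "\<dots> = (\<Prod>k\<in>J. \<integral>\<^sup>+ x. ennreal (exp (- t * x^2 / 2 + c * w k * x)) \<partial>std_normal_distribution)"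
      by (rule PJ.product_nn_integral_prod[OF J]) auto
    also have "\<dots> = (\<Prod>k\<in>J. ennreal ((1 / sqrt (1 + t)) * exp (t / (1 + t) / 2 * (w k)^2)))"
      using t c by (subst nn_integral_std_normal_exp_quadratic) (auto simp: power_mult_distrib field_simps)
    also have "\<dots> = ennreal ((1 / sqrt (1 + t)) ^ card J * exp (t / (1 + t) / 2 * (\<Sum>k\<in>J. (w k)^2)))"
      using t by (simp add: prod_ennreal prod_dividef power_divide exp_sum[OF J, symmetric] sum_distrib_left)
    also have "(\<Sum>k\<in>J. (w k)^2) = (\<Sum>i<d. (g i)^2)"
      unfolding w_def by (rule sum_square_orthonormal_combination[OF u])
    also have "ennreal ((1 / sqrt (1 + t)) ^ card J * exp (t / (1 + t) / 2 * (\<Sum>i<d. (g i)^2)))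
        = ennreal ((1 / sqrt (1 + t)) ^ card J) * (\<Prod>i<d. ennreal (exp (t / (1 + t) * (g i)^2 / 2)))"
      using t by (simp add: ennreal_mult prod_ennreal exp_sum[symmetric] sum_distrib_left)
    finally show "(\<integral>\<^sup>+ y. ennreal (exp (- t / 2 * (\<Sum>k\<in>J. (y k)^2) + (\<Sum>i<d. c * (\<Sum>k\<in>J. u i k * y k) * g i))) \<partial>std_gaussian J)
       = ennreal ((1 / sqrt (1 + t)) ^ card J) * (\<Prod>i<d. ennreal (exp (t / (1 + t) * (g i)^2 / 2)))" .
  qed
  also have "\<dots> = ennreal ((1 / sqrt (1 + t)) ^ card J) * (\<Prod>i<d. \<integral>\<^sup>+ x. ennreal (exp (t / (1 + t) * x^2 / 2)) \<partial>std_normal_distribution)"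
  proof -
    have "(\<integral>\<^sup>+ g. (\<Prod>i<d. ennreal (exp (t / (1 + t) * (g i)^2 / 2))) \<partial>std_gaussian {..<d})
        = (\<Prod>i<d. \<integral>\<^sup>+ x. ennreal (exp (t / (1 + t) * x^2 / 2)) \<partial>std_normal_distribution)"
      by (rule PD.product_nn_integral_prod) auto
    then show ?thesis by (subst nn_integral_cmult) simp_all
  qed
  also have "(\<integral>\<^sup>+ x. ennreal (exp (t / (1 + t) * x^2 / 2)) \<partial>std_normal_distribution) = ennreal (sqrt (1 + t))"
  proof -
    have "1 - t / (1 + t) = 1 / (1 + t)" using t by (simp add: field_simps)
    then show ?thesis using nn_integral_std_normal_exp_quadratic[of "t / (1 + t)" 0] t by (simp add: real_sqrt_divide)
  qed
  finally show ?thesis using t by (simp add: prod_constant ennreal_power ennreal_mult)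
qed

section \<open>The Gamma law\<close>

text \<open>
  The Laplace transform of \<open>X\<close> at \<open>k\<close> is the \<open>k\<close>-th moment of \<open>exp (- X)\<close>, which lies in the unit interval.
  For such a variable the Taylor expansion of the characteristic function converges, so the moments
  determine the law.
\<close>

lemma distr_eq_of_Laplace_transform_eq:
  fixes X :: "'a \<Rightarrow> real" and Y :: "'b \<Rightarrow> real"
  assumes M: "prob_space M" and N: "prob_space N"
    and X [measurable]: "X \<in> borel_measurable M" and Y [measurable]: "Y \<in> borel_measurable N"
    and X0: "AE x in M. 0 \<le> X x" and Y0: "AE y in N. 0 \<le> Y y"
    and eq: "\<And>k :: nat. (\<integral>\<^sup>+ x. ennreal (exp (- real k * X x)) \<partial>M) = (\<integral>\<^sup>+ y. ennreal (exp (- real k * Y y)) \<partial>N)"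
  shows "distr M borel X = distr N borel Y"
proof -
  interpret M: prob_space M by fact
  interpret N: prob_space N by fact
  \<comment> \<open>The truncation at 0 changes X only on a null set and bounds U everywhere.\<close>
  define U where "U x = exp (- max 0 (X x))" for x
  define V where "V y = exp (- max 0 (Y y))" for y
  have [measurable]: "U \<in> borel_measurable M" "V \<in> borel_measurable N" by (simp_all add: U_def[abs_def] V_def[abs_def])
  have U: "0 \<le> U x" "U x \<le> 1" for x by (auto simp: U_def)
  have V: "0 \<le> V y" "V y \<le> 1" for y by (auto simp: V_def)
  have iU: "integrable M (\<lambda>x. U x ^ k)" for k
    by (rule M.integrable_const_bound[of _ 1]) (use U in \<open>auto intro: power_le_one\<close>)
  have iV: "integrable N (\<lambda>x. V x ^ k)" for k
    by (rule N.integrable_const_bound[of _ 1]) (use V in \<open>auto intro: power_le_one\<close>)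
  have moments: "M.expectation (\<lambda>x. U x ^ k) = N.expectation (\<lambda>y. V y ^ k)" for k
  proof -
    have "ennreal (M.expectation (\<lambda>x. U x ^ k)) = (\<integral>\<^sup>+ x. ennreal (U x ^ k) \<partial>M)"
      using U by (intro nn_integral_eq_integral[symmetric] iU) auto
    also have "\<dots> = (\<integral>\<^sup>+ x. ennreal (exp (- real k * X x)) \<partial>M)"
      by (rule nn_integral_cong_AE) (use X0 in eventually_elim, simp add: U_def exp_of_nat_mult[symmetric])
    also have "\<dots> = (\<integral>\<^sup>+ y. ennreal (V y ^ k) \<partial>N)"
      unfolding eq by (rule nn_integral_cong_AE) (use Y0 in eventually_elim, simp add: V_def exp_of_nat_mult[symmetric])
    also have "\<dots> = ennreal (N.expectation (\<lambda>y. V y ^ k))"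
      using V by (intro nn_integral_eq_integral iV) auto
    finally show ?thesis using U V by (simp add: integral_nonneg_AE)
  qed
  have "distr M borel U = distr N borel V"
  proof (rule Levy_uniqueness)
    show "real_distribution (distr M borel U)" "real_distribution (distr N borel V)" by simp_all
    show "char (distr M borel U) = char (distr N borel V)"
    proof
      fix t :: real
      have "norm (char (distr M borel U) t - char (distr N borel V) t) \<le> 4 * (\<bar>t\<bar> ^ n / fact n)" for n
      proof -
        define S where "S = (\<Sum>k \<le> n. ((\<i> * t)^k / fact k) * M.expectation (\<lambda>x. U x ^ k))"
        have "M.expectation (\<lambda>x. \<bar>U x\<bar>^n) \<le> M.expectation (\<lambda>x. 1)"
          by (rule integral_mono) (use U iU in \<open>auto simp: power_le_one\<close>)
        moreover have "N.expectation (\<lambda>x. \<bar>V x\<bar>^n) \<le> N.expectation (\<lambda>x. 1)"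
          by (rule integral_mono) (use V iV in \<open>auto simp: power_le_one\<close>)
        ultimately have *: "(2*\<bar>t\<bar>^n / fact n) * M.expectation (\<lambda>x. \<bar>U x\<bar>^n) \<le> (2*\<bar>t\<bar>^n / fact n) * 1"
          "(2*\<bar>t\<bar>^n / fact n) * N.expectation (\<lambda>x. \<bar>V x\<bar>^n) \<le> (2*\<bar>t\<bar>^n / fact n) * 1"
          by (intro mult_left_mono; simp add: M.prob_space N.prob_space)+
        have "norm (char (distr M borel U) t - S) \<le> (2*\<bar>t\<bar>^n / fact n) * 1"
          using M.char_approx1'[OF iU _ refl, where n = n and t = t] * unfolding S_def by auto
        moreover have "norm (char (distr N borel V) t - S) \<le> (2*\<bar>t\<bar>^n / fact n) * 1"
          using N.char_approx1'[OF iV _ refl, where n = n and t = t] * unfolding S_def moments by auto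
        ultimately have "norm ((char (distr M borel U) t - S) - (char (distr N borel V) t - S)) \<le> (2*\<bar>t\<bar>^n / fact n) * 1 + (2*\<bar>t\<bar>^n / fact n) * 1"
          using norm_triangle_ineq4[of "char (distr M borel U) t - S" "char (distr N borel V) t - S"] by linarith
        then show ?thesis by simp
      qed
      moreover have "(\<lambda>n. 4 * (\<bar>t\<bar> ^ n / fact n)) \<longlonglongrightarrow> 4 * 0"
        using summable_LIMSEQ_zero[OF summable_exp[of "\<bar>t\<bar>"]] by (intro tendsto_mult_left) (simp add: divide_inverse mult.commute)
      ultimately have "norm (char (distr M borel U) t - char (distr N borel V) t) \<le> 4 * 0"
        by (intro LIMSEQ_le_const) auto
      then show "char (distr M borel U) t = char (distr N borel V) t" by simp
    qed
  qed
  then have "distr (distr M borel U) borel (\<lambda>x. - ln x) = distr (distr N borel V) borel (\<lambda>x. - ln x)" by simp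
  then have "distr M borel (\<lambda>x. max 0 (X x)) = distr N borel (\<lambda>y. max 0 (Y y))"
    by (simp add: distr_distr comp_def U_def[abs_def] V_def[abs_def])
  moreover have "distr M borel (\<lambda>x. max 0 (X x)) = distr M borel X"
    by (rule distr_cong_AE) (use X0 in auto)
  moreover have "distr N borel (\<lambda>x. max 0 (Y x)) = distr N borel Y"
    by (rule distr_cong_AE) (use Y0 in auto)
  ultimately show ?thesis by simp
qed

text \<open>
  The Gamma law with shape \<open>a\<close> and scale 1: half of a chi-square variable with \<open>2 a\<close> degrees of freedom.
\<close>

definition gamma_density :: "real \<Rightarrow> real \<Rightarrow> real" where
  "gamma_density a x = (if x > 0 then x powr (a - 1) * exp (- x) / Gamma a else 0)"

lemma gamma_density_measurable [measurable]: "gamma_density a \<in> borel_measurable borel"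
  unfolding gamma_density_def[abs_def] by measurable

lemma gamma_density_nonneg: "a > 0 \<Longrightarrow> gamma_density a x \<ge> 0"
  using Gamma_real_pos[of a] by (auto simp: gamma_density_def)

lemma gamma_Laplace_transform:
  fixes a t :: real assumes a: "a > 0" and t: "t \<ge> 0"
  shows "(\<integral>\<^sup>+ x. ennreal (exp (- t * x)) \<partial>density lborel (gamma_density a)) = ennreal ((1 + t) powr (- a))"
proof -
  define f where "f x = indicator {0..} x * x powr (a - 1) / exp x" for x :: real
  have [measurable]: "f \<in> borel_measurable borel" unfolding f_def[abs_def] by measurable
  have f0: "f x \<ge> 0" for x by (auto simp: f_def)
  have G: "Gamma a > 0" using a by (rule Gamma_real_pos)
  have "ennreal (Gamma a) = (\<integral>\<^sup>+ x. ennreal (f x) \<partial>lborel)"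
    using Gamma_conv_nn_integral_real[OF a] by (simp add: f_def)
  also have "\<dots> = ennreal (1 + t) * (\<integral>\<^sup>+ x. ennreal (f ((1 + t) * x)) \<partial>lborel)"
    using t by (subst nn_integral_real_affine[where c="1 + t" and t=0]) auto
  also have "(\<integral>\<^sup>+ x. ennreal (f ((1 + t) * x)) \<partial>lborel) = (\<integral>\<^sup>+ x. ennreal ((1 + t) powr (a - 1) * Gamma a) * (ennreal (gamma_density a x) * ennreal (exp (- t * x))) \<partial>lborel)"
  proof (rule nn_integral_cong_AE)
    have "AE x in lborel. x \<noteq> (0::real)" by (rule AE_lborel_singleton)
    then show "AE x in lborel. ennreal (f ((1 + t) * x)) = ennreal ((1 + t) powr (a - 1) * Gamma a) * (ennreal (gamma_density a x) * ennreal (exp (- t * x)))"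
    proof eventually_elim
      case (elim x)
      have "f ((1 + t) * x) = ((1 + t) powr (a - 1) * Gamma a) * (gamma_density a x * exp (- t * x))"
      proof (cases "x > 0")
        case True
        have e: "((1 + t) * x) powr (a - 1) = (1 + t) powr (a - 1) * x powr (a - 1)" "exp ((1 + t) * x) = exp x * exp (t * x)"
          using True t by (intro powr_mult, simp add: distrib_right exp_add)
        have "f ((1 + t) * x) = ((1 + t) powr (a - 1) * x powr (a - 1)) / (exp x * exp (t * x))"
          using True t unfolding f_def e by simp
        then show ?thesis using True G by (simp add: gamma_density_def exp_minus divide_inverse)
      next
        case False
        then have "\<not> 0 \<le> (1 + t) * x" using elim t by (simp add: zero_le_mult_iff)
        then show ?thesis using False by (simp add: f_def gamma_density_def)
      qed
      then show ?case using a G by (simp add: ennreal_mult gamma_density_nonneg)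
    qed
  qed
  also have "\<dots> = ennreal ((1 + t) powr (a - 1) * Gamma a) * (\<integral>\<^sup>+ x. ennreal (exp (- t * x)) \<partial>density lborel (gamma_density a))"
    by (subst nn_integral_density, simp, simp, subst nn_integral_cmult) auto
  finally have **: "ennreal (Gamma a) = ennreal (1 + t) * (ennreal ((1 + t) powr (a - 1) * Gamma a) * (\<integral>\<^sup>+ x. ennreal (exp (- t * x)) \<partial>density lborel (gamma_density a)))" .
  have *: "ennreal (Gamma a) = ennreal ((1 + t) powr a * Gamma a) * (\<integral>\<^sup>+ x. ennreal (exp (- t * x)) \<partial>density lborel (gamma_density a))"
  proof -
    have "ennreal (1 + t) * ennreal ((1 + t) powr (a - 1) * Gamma a) = ennreal ((1 + t) powr a * Gamma a)"
      using t G by (subst ennreal_mult[symmetric]) (auto simp: mult.assoc[symmetric] powr_mult_base)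
    then show ?thesis using ** by (simp only: mult.assoc[symmetric])
  qed
  have "ennreal ((1 + t) powr (- a)) = ennreal ((1 + t) powr (- a) / Gamma a) * ennreal (Gamma a)"
    using G t by (simp add: ennreal_mult[symmetric])
  also have "\<dots> = ennreal ((1 + t) powr (- a) / Gamma a * ((1 + t) powr a * Gamma a)) * (\<integral>\<^sup>+ x. ennreal (exp (- t * x)) \<partial>density lborel (gamma_density a))"
  proof -
    have "ennreal ((1 + t) powr (- a) / Gamma a * ((1 + t) powr a * Gamma a)) = ennreal ((1 + t) powr (- a) / Gamma a) * ennreal ((1 + t) powr a * Gamma a)"
      using G t by (intro ennreal_mult) auto
    then show ?thesis unfolding * by (simp only: mult.assoc)
  qed
  also have "(1 + t) powr (- a) / Gamma a * ((1 + t) powr a * Gamma a) = 1"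
    using G t by (simp add: powr_minus field_simps)
  finally show ?thesis by simp
qed

lemma prob_space_gamma: "a > 0 \<Longrightarrow> prob_space (density lborel (gamma_density a))"
  using gamma_Laplace_transform[of a 0] by (intro prob_spaceI) (simp add: emeasure_density nn_integral_density)

lemma gamma_positive: "AE x in density lborel (gamma_density a). x > 0"
  by (subst AE_density) (auto simp: gamma_density_def)

lemma gamma_Mellin_transform:
  fixes a s :: real assumes a: "a > 0"
  shows "(\<integral> x. iexp (s * ln x) \<partial>density lborel (gamma_density a)) = Gamma (Complex a s) / Gamma (of_real a)"
proof -
  define z where "z = Complex a s"
  have z: "Re z > 0" using a by (simp add: z_def)
  have G: "Gamma a > 0" using a by (rule Gamma_real_pos)
  define h where "h x = complex_of_real x powr (z - 1) / of_real (exp x)" for x :: real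
  have *: "gamma_density a x *\<^sub>R iexp (s * ln x) = (1 / Gamma a) *\<^sub>R (indicator {0<..} x *\<^sub>R h x)" for x
  proof (cases "x > 0")
    case True
    have "complex_of_real x powr (z - 1) = of_real (x powr (a - 1)) * iexp (s * ln x)"
      using True by (simp add: z_def powr_def exp_of_real[symmetric] exp_add[symmetric] Ln_of_real algebra_simps complex_eq_iff Complex_eq)
    then show ?thesis using True by (simp add: gamma_density_def h_def exp_minus scaleR_conv_of_real field_simps)
  qed (simp add: gamma_density_def)
  have hm: "(\<lambda>x. indicator {0<..} x *\<^sub>R h x) \<in> borel_measurable lborel"
  proof -
    have "(\<lambda>x. (1 / Gamma a) *\<^sub>R (indicator {0<..} x *\<^sub>R h x)) \<in> borel_measurable lborel"
      unfolding *[symmetric] by measurable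
    from borel_measurable_scaleR[OF borel_measurable_const[of "Gamma a"] this] show ?thesis using G by simp
  qed
  have "(\<integral> x. iexp (s * ln x) \<partial>density lborel (gamma_density a)) = (\<integral> x. gamma_density a x *\<^sub>R iexp (s * ln x) \<partial>lborel)"
    using a by (intro integral_density) (auto simp: gamma_density_nonneg)
  also have "\<dots> = (1 / Gamma a) *\<^sub>R (\<integral> x. indicator {0<..} x *\<^sub>R h x \<partial>lborel)"
    by (simp only: * integral_scaleR_right)
  also have "(\<integral> x. indicator {0<..} x *\<^sub>R h x \<partial>lborel) = (LINT x:{0<..}|lebesgue. h x)"
    unfolding set_lebesgue_integral_def by (rule integral_completion[symmetric, OF hm])
  also have "\<dots> = integral {0<..} h"
    using absolutely_integrable_Gamma_integral'[OF z] unfolding h_def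
    by (intro set_lebesgue_integral_eq_integral)
  also have "\<dots> = Gamma z"
    using Gamma_integral_complex'[OF z] unfolding h_def by (rule integral_unique)
  finally show ?thesis by (simp add: z_def Gamma_complex_of_real scaleR_conv_of_real)
qed

lemma residual_square_gamma:
  fixes u :: "nat \<Rightarrow> 'i \<Rightarrow> real"
  assumes J: "finite J" and u: "orthonormal_on J d u" and d: "d < card J"
  shows "distr (std_gaussian J) borel (\<lambda>y. residual_square J d u y / 2)
     = density lborel (gamma_density (real (card J - d) / 2))"
proof -
  define a where "a = real (card J - d) / 2"
  have a: "a > 0" using d by (simp add: a_def)
  have "distr (std_gaussian J) borel (\<lambda>y. residual_square J d u y / 2)
     = distr (density lborel (gamma_density a)) borel (\<lambda>x. x)"
  proof (rule distr_eq_of_Laplace_transform_eq)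
    show "prob_space (std_gaussian J)" by (rule prob_space_std_gaussian)
    show "prob_space (density lborel (gamma_density a))" using a by (rule prob_space_gamma)
    show "AE x in density lborel (gamma_density a). 0 \<le> x" using gamma_positive by eventually_elim simp
    fix k :: nat
    have "(1 / sqrt (1 + real k)) ^ card J * (sqrt (1 + real k)) ^ d = (1 + real k) powr (- a)"
    proof -
      have "(1 / sqrt (1 + real k)) ^ card J = (1 + real k) powr (- real (card J) / 2)"
        by (simp add: powr_half_sqrt[symmetric] powr_minus_divide powr_realpow[symmetric] powr_powr power_divide)
      moreover have "(sqrt (1 + real k)) ^ d = (1 + real k) powr (real d / 2)"
        by (simp add: powr_half_sqrt[symmetric] powr_realpow[symmetric] powr_powr)
      ultimately show ?thesis using d by (simp only: powr_add[symmetric]) (rule arg_cong2[where f = "(powr)"], simp_all add: a_def of_nat_diff field_simps)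
    qed
    then show "(\<integral>\<^sup>+ y. ennreal (exp (- real k * (residual_square J d u y / 2))) \<partial>std_gaussian J)
       = (\<integral>\<^sup>+ x. ennreal (exp (- real k * x)) \<partial>density lborel (gamma_density a))"
      unfolding gamma_Laplace_transform[OF a of_nat_0_le_iff] nn_integral_exp_residual_square[OF J u of_nat_0_le_iff] by simp
  qed (use residual_square_nonneg[OF u] in auto)
  also have "\<dots> = density lborel (gamma_density a)" by (rule distr_id2) simp
  finally show ?thesis by (simp add: a_def)
qed

text \<open>
  The right-hand side depends on \<open>u\<close> only through \<open>d\<close>.  This is what makes the columns of
  a Gaussian array contribute independent factors to its Gram determinant.
\<close>

lemma residual_square_log_char:
  fixes u :: "nat \<Rightarrow> 'i \<Rightarrow> real" and s :: real
  assumes J: "finite J" and u: "orthonormal_on J d u" and d: "d < card J"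
  defines "a \<equiv> real (card J - d) / 2"
  shows "AE y in std_gaussian J. residual_square J d u y > 0"
    and "(\<integral> y. iexp (s * ln (residual_square J d u y)) \<partial>std_gaussian J)
      = iexp (s * ln 2) * (Gamma (Complex a s) / Gamma (of_real a))"
proof -
  have a: "a > 0" using d by (simp add: a_def)
  note eq = residual_square_gamma[OF J u d, folded a_def]
  have "AE x in distr (std_gaussian J) borel (\<lambda>y. residual_square J d u y / 2). x > 0"
    unfolding eq by (rule gamma_positive)
  then have "AE y in std_gaussian J. residual_square J d u y / 2 > 0"
    by (subst (asm) AE_distr_iff) auto
  then show pos: "AE y in std_gaussian J. residual_square J d u y > 0" by simp
  have "(\<integral> y. iexp (s * ln (residual_square J d u y)) \<partial>std_gaussian J)
     = (\<integral> y. iexp (s * ln 2) * iexp (s * ln (residual_square J d u y / 2)) \<partial>std_gaussian J)"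
  proof (rule integral_cong_AE)
    show "AE y in std_gaussian J. iexp (s * ln (residual_square J d u y))
       = iexp (s * ln 2) * iexp (s * ln (residual_square J d u y / 2))"
      using pos by eventually_elim (simp add: ln_div exp_add[symmetric] algebra_simps)
  qed measurable
  also have "\<dots> = iexp (s * ln 2) * (\<integral> y. iexp (s * ln (residual_square J d u y / 2)) \<partial>std_gaussian J)"
    by simp
  also have "(\<integral> y. iexp (s * ln (residual_square J d u y / 2)) \<partial>std_gaussian J)
     = (\<integral> x. iexp (s * ln x) \<partial>distr (std_gaussian J) borel (\<lambda>y. residual_square J d u y / 2))"
    by (subst integral_distr) auto
  also have "\<dots> = Gamma (Complex a s) / Gamma (of_real a)"
    unfolding eq by (rule gamma_Mellin_transform[OF a])
  finally show "(\<integral> y. iexp (s * ln (residual_square J d u y)) \<partial>std_gaussian J)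
      = iexp (s * ln 2) * (Gamma (Complex a s) / Gamma (of_real a))" .
qed

section \<open>Gram determinants and orthonormalization\<close>

definition gram_mat :: "'i set \<Rightarrow> nat \<Rightarrow> (nat \<Rightarrow> 'i \<Rightarrow> real) \<Rightarrow> real mat" where
  "gram_mat J p c = mat p p (\<lambda>(i, j). \<Sum>k\<in>J. c i k * c j k)"

lemma det_lower_triangular_fun:
  fixes l :: "nat \<Rightarrow> nat \<Rightarrow> real"
  assumes "\<And>i j. i < j \<Longrightarrow> j < p \<Longrightarrow> l i j = 0"
  shows "det (mat p p (\<lambda>(i, j). l i j)) = (\<Prod>i<p. l i i)"
  by (subst det_lower_triangular[of p])
    (use assms in \<open>auto simp: prod_list_diag_prod lessThan_atLeast0 intro!: prod.cong\<close>)

lemma mat_mult_transpose_fun: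
  fixes a b :: "nat \<Rightarrow> nat \<Rightarrow> real"
  shows "mat p p (\<lambda>(i, j). a i j) * transpose_mat (mat p p (\<lambda>(i, j). b i j)) = mat p p (\<lambda>(i, j). \<Sum>k<p. a i k * b j k)"
  by (rule eq_matI) (auto simp: scalar_prod_def lessThan_atLeast0 intro!: sum.cong)

lemma det_mult_transpose_lower_triangular:
  fixes l m :: "nat \<Rightarrow> nat \<Rightarrow> real"
  assumes "\<And>i j. i < j \<Longrightarrow> j < p \<Longrightarrow> l i j = 0" "\<And>i j. i < j \<Longrightarrow> j < p \<Longrightarrow> m i j = 0"
  shows "det (mat p p (\<lambda>(i, j). \<Sum>k<p. l i k * m j k)) = (\<Prod>i<p. l i i) * (\<Prod>i<p. m i i)"
  unfolding mat_mult_transpose_fun[symmetric]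
  by (subst det_mult[of _ p], simp, simp, subst det_transpose[of _ p], simp)
    (simp add: det_lower_triangular_fun assms)

text \<open>
  With \<open>w\<close> the coefficients of the new column along \<open>u\<close>, and \<open>q\<close> its squared distance to the span, the enlarged Gram
  matrix is the product of the lower triangular matrix with rows \<open>(l, 0), (w, 1)\<close> and the transpose of
  the one with rows \<open>(l, 0), (w, q)\<close>.
\<close>

lemma det_gram_mat_step:
  assumes u: "orthonormal_on J p u"
    and c: "\<And>i k. i < p \<Longrightarrow> k \<in> J \<Longrightarrow> c i k = (\<Sum>m<p. l i m * u m k)"
    and l: "\<And>i j. i < j \<Longrightarrow> j < p \<Longrightarrow> l i j = 0"
  shows "det (gram_mat J p c) = (\<Prod>i<p. l i i)^2"
    and "det (gram_mat J (Suc p) c) = (\<Prod>i<p. l i i)^2 * residual_square J p u (c p)"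
proof -
  have cu: "(\<Sum>k\<in>J. u m k * c i k) = l i m" if "i < p" "m < p" for i m
  proof -
    have "(\<Sum>k\<in>J. u m k * c i k) = (\<Sum>k\<in>J. \<Sum>q<p. l i q * (u m k * u q k))"
      using that by (intro sum.cong refl) (simp add: c sum_distrib_left algebra_simps)
    also have "\<dots> = (\<Sum>q<p. l i q * (\<Sum>k\<in>J. u m k * u q k))"
      by (subst sum.swap) (simp add: sum_distrib_left)
    also have "\<dots> = (\<Sum>q<p. if m = q then l i q else 0)"
      using u that by (intro sum.cong refl) (auto simp: orthonormal_on_def)
    also have "\<dots> = l i m" using that by simp
    finally show ?thesis .
  qed
  have inner: "(\<Sum>k\<in>J. c i k * v k) = (\<Sum>m<p. l i m * (\<Sum>k\<in>J. u m k * v k))" if "i < p" for i v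
  proof -
    have "(\<Sum>k\<in>J. c i k * v k) = (\<Sum>k\<in>J. \<Sum>m<p. l i m * (u m k * v k))"
      using that by (intro sum.cong refl) (simp add: c sum_distrib_right mult.assoc)
    then show ?thesis by (subst (asm) sum.swap) (simp add: sum_distrib_left)
  qed
  have cc: "(\<Sum>k\<in>J. c i k * c j k) = (\<Sum>m<p. l i m * l j m)" if "i < p" "j < p" for i j
    using that by (simp add: inner cu)
  have "gram_mat J p c = mat p p (\<lambda>(i, j). \<Sum>k<p. l i k * l j k)"
    unfolding gram_mat_def by (rule cong_mat) (auto simp: cc)
  then show "det (gram_mat J p c) = (\<Prod>i<p. l i i)^2"
    using det_mult_transpose_lower_triangular[of p l l, OF l l] by (simp add: power2_eq_square)
  define w where "w m = (\<Sum>k\<in>J. u m k * c p k)" for m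
  define a where "a i j = (if i < p then if j < p then l i j else 0 else if j < p then w j else 1)" for i j
  define b where "b i j = (if i < p then if j < p then l i j else 0 else if j < p then w j else residual_square J p u (c p))" for i j
  have "(\<Sum>k\<in>J. c i k * c j k) = (\<Sum>k<Suc p. a i k * b j k)" if ij: "i < Suc p" "j < Suc p" for i j
  proof -
    consider "i < p" "j < p" | "i < p" "j = p" | "i = p" "j < p" | "i = p" "j = p"
      using ij by (auto simp: less_Suc_eq)
    then show ?thesis
    proof cases
      case 3
      have "(\<Sum>k\<in>J. c p k * c j k) = (\<Sum>k\<in>J. c j k * c p k)" by (simp add: mult.commute)
      then show ?thesis using 3 by (simp add: a_def b_def inner w_def mult.commute)
    next
      case 4
      then show ?thesis by (simp add: a_def b_def residual_square_def w_def power2_eq_square)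
    qed (simp_all add: a_def b_def cc inner w_def)
  qed
  then have "gram_mat J (Suc p) c = mat (Suc p) (Suc p) (\<lambda>(i, j). \<Sum>k<Suc p. a i k * b j k)"
    unfolding gram_mat_def by (intro cong_mat) auto
  moreover have "det (mat (Suc p) (Suc p) (\<lambda>(i, j). \<Sum>k<Suc p. a i k * b j k)) = (\<Prod>i<Suc p. a i i) * (\<Prod>i<Suc p. b i i)"
    by (rule det_mult_transpose_lower_triangular) (auto simp: a_def b_def l)
  moreover have "(\<Prod>i<p. a i i) = (\<Prod>i<p. l i i)" "(\<Prod>i<p. b i i) = (\<Prod>i<p. l i i)"
    by (auto simp: a_def b_def intro!: prod.cong)
  ultimately show "det (gram_mat J (Suc p) c) = (\<Prod>i<p. l i i)^2 * residual_square J p u (c p)"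
    by (simp add: a_def b_def power2_eq_square)
qed

text \<open>
  Gram-Schmidt.  Nonvanishing of all leading Gram determinants is assumed rather than derived from the
  last one, since almost sure positivity is available for all of them at once.
  The orthonormal vectors inherit from the \<open>c i\<close> that their entries sum to 0.
\<close>

lemma orthonormalization_exists:
  fixes c :: "nat \<Rightarrow> 'i \<Rightarrow> real"
  assumes "\<And>q. q \<le> p \<Longrightarrow> det (gram_mat J q c) \<noteq> 0" and "\<And>i. i < p \<Longrightarrow> (\<Sum>k\<in>J. c i k) = 0"
  shows "\<exists>u l. orthonormal_on J p u \<and> (\<forall>i<p. (\<Sum>k\<in>J. u i k) = 0) \<and>
     (\<forall>i<p. \<forall>k\<in>J. c i k = (\<Sum>m<p. l i m * u m k)) \<and> (\<forall>i j. i < j \<longrightarrow> j < p \<longrightarrow> l i j = 0)"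
  using assms
proof (induction p)
  case 0
  then show ?case by (auto simp: orthonormal_on_def)
next
  case (Suc p)
  have "\<exists>u l. orthonormal_on J p u \<and> (\<forall>i<p. (\<Sum>k\<in>J. u i k) = 0) \<and>
     (\<forall>i<p. \<forall>k\<in>J. c i k = (\<Sum>m<p. l i m * u m k)) \<and> (\<forall>i j. i < j \<longrightarrow> j < p \<longrightarrow> l i j = (0::real))"
    using Suc.prems by (intro Suc.IH) auto
  then obtain u l where u: "orthonormal_on J p u" "\<And>i. i < p \<Longrightarrow> (\<Sum>k\<in>J. u i k) = 0"
    and c: "\<And>i k. i < p \<Longrightarrow> k \<in> J \<Longrightarrow> c i k = (\<Sum>m<p. l i m * u m k)"
    and l: "\<And>i j. i < j \<Longrightarrow> j < p \<Longrightarrow> l i j = (0::real)"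
    by blast
  define \<rho> where "\<rho> = sqrt (residual_square J p u (c p))"
  have "residual_square J p u (c p) \<noteq> 0"
    using Suc.prems(1)[of "Suc p"] det_gram_mat_step(2)[OF u(1) c l] by auto
  then have \<rho>: "\<rho> > 0" "\<rho>^2 = residual_square J p u (c p)"
    using residual_square_nonneg[OF u(1), of "c p"] by (auto simp: \<rho>_def)
  define w where "w m = (\<Sum>k\<in>J. u m k * c p k)" for m
  define v where "v k = (c p k - (\<Sum>m<p. w m * u m k)) / \<rho>" for k
  define u' where "u' i = (if i < p then u i else v)" for i
  define l' where "l' i j = (if i < p then if j < p then l i j else 0 else if j < p then w j else \<rho>)" for i j
  have vv: "(\<Sum>k\<in>J. v k * v k) = 1"
  proof -
    have "(\<Sum>k\<in>J. v k * v k) = (\<Sum>k\<in>J. (c p k - (\<Sum>m<p. w m * u m k))^2) / \<rho>^2"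
      by (simp add: v_def power2_eq_square sum_divide_distrib[symmetric])
    also have "(\<Sum>k\<in>J. (c p k - (\<Sum>m<p. w m * u m k))^2) = \<rho>^2"
      unfolding w_def using residual_square_eq[OF u(1), of "c p"] \<rho>(2) by simp
    finally show ?thesis using \<rho>(1) by simp
  qed
  have uv: "(\<Sum>k\<in>J. u i k * v k) = 0" if "i < p" for i
  proof -
    have "(\<Sum>k\<in>J. u i k * (\<Sum>m<p. w m * u m k)) = (\<Sum>m<p. w m * (\<Sum>k\<in>J. u i k * u m k))"
      by (simp add: sum_distrib_left) (subst sum.swap, simp add: algebra_simps)
    also have "\<dots> = (\<Sum>m<p. if i = m then w m else 0)"
      using u(1) that by (intro sum.cong refl) (auto simp: orthonormal_on_def)
    also have "\<dots> = w i" using that by simp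
    finally have "(\<Sum>k\<in>J. u i k * (c p k - (\<Sum>m<p. w m * u m k))) = 0"
      by (simp add: right_diff_distrib sum_subtractf w_def)
    then show ?thesis by (simp add: v_def sum_divide_distrib[symmetric])
  qed
  have v0: "(\<Sum>k\<in>J. v k) = 0"
  proof -
    have "(\<Sum>k\<in>J. \<Sum>m<p. w m * u m k) = 0"
      by (subst sum.swap) (simp add: sum_distrib_left[symmetric] u(2))
    then show ?thesis using Suc.prems(2)[of p] by (simp add: v_def sum_divide_distrib[symmetric] sum_subtractf)
  qed
  have "orthonormal_on J (Suc p) u'"
    using u(1) uv vv by (auto simp: orthonormal_on_def u'_def less_Suc_eq mult.commute)
  moreover have "\<forall>i<Suc p. (\<Sum>k\<in>J. u' i k) = 0" using u(2) v0 by (auto simp: u'_def)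
  moreover have "\<forall>i<Suc p. \<forall>k\<in>J. c i k = (\<Sum>m<Suc p. l' i m * u' m k)"
  proof safe
    fix i k assume "i < Suc p" "k \<in> J"
    then consider "i < p" | "i = p" by linarith
    then show "c i k = (\<Sum>m<Suc p. l' i m * u' m k)"
      by cases (use \<open>k \<in> J\<close> \<rho> in \<open>auto simp: c l'_def u'_def v_def\<close>)
  qed
  moreover have "\<forall>i j. i < j \<longrightarrow> j < Suc p \<longrightarrow> l' i j = 0" using l by (auto simp: l'_def)
  ultimately show ?case by blast
qed

text \<open>
  Centering is the orthogonal projection that removes the constant component.  So the distance of a centered
  vector to the span of vectors of sum 0 is the distance of the raw vector to the span enlarged by the constants.
\<close>

lemma residual_square_centered:
  fixes u :: "nat \<Rightarrow> 'i \<Rightarrow> real" and y :: "'i \<Rightarrow> real"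
  assumes J: "finite J" "J \<noteq> {}" and u: "orthonormal_on J p u" and u0: "\<And>i. i < p \<Longrightarrow> (\<Sum>k\<in>J. u i k) = 0"
  defines "e \<equiv> \<lambda>i k. case i of 0 \<Rightarrow> 1 / sqrt (card J) | Suc i \<Rightarrow> u i k"
  shows "orthonormal_on J (Suc p) e"
    and "residual_square J p u (\<lambda>k. y k - (\<Sum>k\<in>J. y k) / card J) = residual_square J (Suc p) e y"
proof -
  have N: "card J > 0" using J by (simp add: card_gt_0_iff)
  show "orthonormal_on J (Suc p) e"
    unfolding orthonormal_on_def
  proof (intro allI impI)
    fix i j assume "i < Suc p" "j < Suc p"
    then show "(\<Sum>k\<in>J. e i k * e j k) = (if i = j then 1 else 0)"
      using u u0 N by (cases i; cases j) (simp_all add: orthonormal_on_def e_def sum_divide_distrib[symmetric])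
  qed
  define m where "m = (\<Sum>k\<in>J. y k) / card J"
  have "(\<Sum>k\<in>J. u i k * (y k - m)) = (\<Sum>k\<in>J. u i k * y k)" if "i < p" for i
    using u0[OF that] by (simp add: right_diff_distrib sum_subtractf sum_distrib_right[symmetric])
  moreover have "(\<Sum>k\<in>J. (y k - m)^2) = (\<Sum>k\<in>J. (y k)^2) - (\<Sum>k\<in>J. e 0 k * y k)^2"
  proof -
    have S: "(\<Sum>k\<in>J. y k) = m * card J" using N by (simp add: m_def)
    have "(\<Sum>k\<in>J. (y k - m)^2) = (\<Sum>k\<in>J. (y k)^2) - 2 * m * (\<Sum>k\<in>J. y k) + card J * m^2"
      by (simp add: power2_diff sum.distrib sum_subtractf sum_distrib_left sum_distrib_right algebra_simps)
    moreover have "(\<Sum>k\<in>J. e 0 k * y k)^2 = card J * m^2"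
      using N by (simp add: e_def sum_divide_distrib[symmetric] S power_divide power_mult_distrib) (simp add: power2_eq_square)
    ultimately show ?thesis unfolding S by (simp add: power2_eq_square)
  qed
  ultimately show "residual_square J p u (\<lambda>k. y k - (\<Sum>k\<in>J. y k) / card J) = residual_square J (Suc p) e y"
    unfolding residual_square_def m_def[symmetric] sum.lessThan_Suc_shift by (simp add: e_def)
qed

definition centered :: "'k set \<Rightarrow> (nat \<times> 'k \<Rightarrow> real) \<Rightarrow> nat \<Rightarrow> 'k \<Rightarrow> real" where
  "centered K z j k = z (j, k) - (\<Sum>k\<in>K. z (j, k)) / real (card K)"

text \<open>
  The array \<open>z\<close> has columns \<open>j < p\<close> and rows \<open>k \<in> K\<close>.  Pairs as indices let a product measure be split
  by columns for the recursion, and by rows for the comparison with the sample.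
\<close>

definition gram_det :: "'k set \<Rightarrow> nat \<Rightarrow> (nat \<times> 'k \<Rightarrow> real) \<Rightarrow> real" where
  "gram_det K p z = det (gram_mat K p (centered K z))"

lemma gram_det_cong:
  assumes "\<And>j k. j < p \<Longrightarrow> k \<in> K \<Longrightarrow> z (j, k) = z' (j, k)"
  shows "gram_det K p z = gram_det K p z'"
proof -
  have "gram_mat K p (centered K z) = gram_mat K p (centered K z')"
    unfolding gram_mat_def centered_def using assms by (intro cong_mat refl) (auto intro!: sum.cong)
  then show ?thesis by (simp add: gram_det_def)
qed

lemma measurable_det [measurable]:
  fixes f :: "'a \<Rightarrow> nat \<Rightarrow> nat \<Rightarrow> real"
  assumes [measurable]: "\<And>i j. i < p \<Longrightarrow> j < p \<Longrightarrow> (\<lambda>x. f x i j) \<in> borel_measurable M"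
  shows "(\<lambda>x. det (mat p p (\<lambda>(i, j). f x i j))) \<in> borel_measurable M"
proof -
  have "(\<lambda>x. \<Sum>\<pi> | \<pi> permutes {0..<p}. signof \<pi> * (\<Prod>i = 0..<p. f x i (\<pi> i))) \<in> borel_measurable M"
    by (intro borel_measurable_sum borel_measurable_times borel_measurable_prod borel_measurable_const assms)
      (auto simp: permutes_in_image)
  also have "(\<lambda>x. \<Sum>\<pi> | \<pi> permutes {0..<p}. signof \<pi> * (\<Prod>i = 0..<p. f x i (\<pi> i))) = (\<lambda>x. det (mat p p (\<lambda>(i, j). f x i j)))"
    by (intro ext, subst det_def'[of _ p], simp) (auto intro!: sum.cong arg_cong2[where f="(*)"] prod.cong simp: permutes_in_image)
  finally show ?thesis .
qed

lemma measurable_gram_det: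
  assumes "{..<p} \<times> K \<subseteq> I"
  shows "gram_det K p \<in> borel_measurable (PiM I (\<lambda>_. borel))"
proof -
  have [measurable]: "(\<lambda>z. z (j, k)) \<in> borel_measurable (PiM I (\<lambda>_. borel))" if "j < p" "k \<in> K" for j k
    using that assms by (intro measurable_component_singleton) auto
  have "(\<lambda>z. \<Sum>k\<in>K. centered K z i k * centered K z j k) \<in> borel_measurable (PiM I (\<lambda>_. borel))" if "i < p" "j < p" for i j
    using that unfolding centered_def by (intro borel_measurable_sum borel_measurable_times borel_measurable_diff borel_measurable_divide) auto
  then show ?thesis unfolding gram_det_def[abs_def] gram_mat_def by (intro measurable_det)
qed

section \<open>The law of a Gaussian Gram determinant\<close>

text \<open>
  The subspace spanned by \<open>e\<close> is that of the constant vector and the old columns; it has full dimension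
  \<open>p + 1\<close> because the old columns are nondegenerate, and it does not depend on the new column \<open>y\<close>.
\<close>

lemma gram_det_new_column:
  fixes x :: "nat \<times> 'k \<Rightarrow> real"
  assumes K: "finite K" "K \<noteq> {}" and pos: "\<And>q. q \<le> p \<Longrightarrow> gram_det K q x > 0"
  obtains e where "orthonormal_on ({p} \<times> K) (Suc p) e"
    "\<And>y. gram_det K (Suc p) (merge ({..<p} \<times> K) ({p} \<times> K) (x, y)) = gram_det K p x * residual_square ({p} \<times> K) (Suc p) e y"
proof -
  have "\<exists>u l. orthonormal_on K p u \<and> (\<forall>i<p. (\<Sum>k\<in>K. u i k) = 0) \<and>
     (\<forall>i<p. \<forall>k\<in>K. centered K x i k = (\<Sum>m<p. l i m * u m k)) \<and> (\<forall>i j. i < j \<longrightarrow> j < p \<longrightarrow> l i j = (0::real))"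
  proof (rule orthonormalization_exists)
    show "det (gram_mat K q (centered K x)) \<noteq> 0" if "q \<le> p" for q
      using pos[OF that] by (simp add: gram_det_def)
    show "(\<Sum>k\<in>K. centered K x i k) = 0" for i
      using K by (simp add: centered_def sum_subtractf card_gt_0_iff)
  qed
  then obtain u l where u: "orthonormal_on K p u" "\<And>i. i < p \<Longrightarrow> (\<Sum>k\<in>K. u i k) = 0"
    and c: "\<And>i k. i < p \<Longrightarrow> k \<in> K \<Longrightarrow> centered K x i k = (\<Sum>m<p. l i m * u m k)"
    and l: "\<And>i j. i < j \<Longrightarrow> j < p \<Longrightarrow> l i j = (0::real)"
    by blast
  define e where "e i k = (case i of 0 \<Rightarrow> 1 / sqrt (card K) | Suc i \<Rightarrow> u i k)" for i k
  note rs = residual_square_centered[OF K u, folded e_def]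
  have sum_K: "(\<Sum>z\<in>{p} \<times> K. f z) = (\<Sum>k\<in>K. f (p, k))" for f :: "nat \<times> 'k \<Rightarrow> real"
    using K by (simp add: sum.cartesian_product[symmetric, of "\<lambda>a b. f (a, b)", simplified])
  have "orthonormal_on ({p} \<times> K) (Suc p) (\<lambda>i z. e i (snd z))"
    using rs(1) by (simp add: orthonormal_on_def sum_K)
  moreover have "gram_det K (Suc p) (merge ({..<p} \<times> K) ({p} \<times> K) (x, y))
      = gram_det K p x * residual_square ({p} \<times> K) (Suc p) (\<lambda>i z. e i (snd z)) y" for y
  proof -
    let ?z = "merge ({..<p} \<times> K) ({p} \<times> K) (x, y)"
    have zx: "centered K ?z i k = centered K x i k" if "i < p" "k \<in> K" for i k
      using that by (auto simp: centered_def merge_def intro!: sum.cong)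
    have zy: "centered K ?z p k = y (p, k) - (\<Sum>k\<in>K. y (p, k)) / card K" if "k \<in> K" for k
      using that by (auto simp: centered_def merge_def intro!: sum.cong)
    have cz: "centered K ?z i k = (\<Sum>m<p. l i m * u m k)" if "i < p" "k \<in> K" for i k
      using c zx that by simp
    note step = det_gram_mat_step[OF u(1) cz l]
    have "residual_square K p u (centered K ?z p) = residual_square K p u (\<lambda>k. y (p, k) - (\<Sum>k\<in>K. y (p, k)) / card K)"
      unfolding residual_square_def using zy by simp
    also have "\<dots> = residual_square K (Suc p) e (\<lambda>k. y (p, k))" by (rule rs(2))
    also have "\<dots> = residual_square ({p} \<times> K) (Suc p) (\<lambda>i z. e i (snd z)) y"
      by (simp add: residual_square_def sum_K)
    finally have r: "residual_square K p u (centered K ?z p) = residual_square ({p} \<times> K) (Suc p) (\<lambda>i z. e i (snd z)) y" .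
    have "gram_det K p ?z = gram_det K p x"
      by (rule gram_det_cong) (auto simp: merge_def)
    then show ?thesis using step r by (simp add: gram_det_def)
  qed
  ultimately show ?thesis by (rule that)
qed

text \<open>
  Integrating out the last column first multiplies the integral by a constant factor.  The restriction to
  nondegenerate arrays makes the recursion exact for every fixed value of the other columns, so that
  nondegeneracy needs no separate proof: it is the case \<open>s = 0\<close>, where the integral is the probability of that event.
\<close>

lemma gram_det_log_char_nondegenerate:
  fixes K :: "'k set" and s :: real
  assumes K: "finite K" and p: "p < card K"
  defines "h \<equiv> \<lambda>p z. if \<forall>q\<le>p. gram_det K q z > 0 then iexp (s * ln (gram_det K p z)) else 0"
  shows "(\<integral> z. h p z \<partial>std_gaussian ({..<p} \<times> K))
    = (\<Prod>j<p. iexp (s * ln 2) * (Gamma (Complex (real (card K - Suc j) / 2) s) / Gamma (of_real (real (card K - Suc j) / 2))))"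
  using p
proof (induction p)
  case 0
  interpret prob_space "std_gaussian ({..<0::nat} \<times> K)" by (rule prob_space_std_gaussian)
  have "gram_det K 0 z = 1" for z by (simp add: gram_det_def gram_mat_def det_def)
  then show ?case using prob_space by (simp add: h_def)
next
  case (Suc p)
  have K0: "K \<noteq> {}" using Suc.prems by auto
  interpret P: product_sigma_finite "\<lambda>_::nat \<times> 'k. std_normal_distribution" by (rule product_sigma_finite_std_normal)
  interpret I: prob_space "std_gaussian ({..<p} \<times> K)" by (rule prob_space_std_gaussian)
  interpret J: prob_space "std_gaussian ({p} \<times> K)" by (rule prob_space_std_gaussian)
  interpret IJ: prob_space "std_gaussian ({..<Suc p} \<times> K)" by (rule prob_space_std_gaussian)
  have meas: "h q \<in> borel_measurable (std_gaussian I)" if "{..<q} \<times> K \<subseteq> I" for q I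
  proof -
    have [measurable]: "gram_det K r \<in> borel_measurable (std_gaussian I)" if "r \<le> q" for r
      unfolding measurable_cong_sets[OF sets_std_gaussian refl]
      by (rule measurable_gram_det) (use that \<open>{..<q} \<times> K \<subseteq> I\<close> in auto)
    have "Measurable.pred (std_gaussian I) (\<lambda>z. \<forall>r\<in>{..q}. gram_det K r z > 0)"
      by (intro pred_intros_finite) auto
    then have [measurable]: "Measurable.pred (std_gaussian I) (\<lambda>z. \<forall>r\<le>q. gram_det K r z > 0)" by simp
    show ?thesis unfolding h_def by measurable
  qed
  have hb: "norm (h q z) \<le> 1" for q z by (simp add: h_def)
  have split: "{..<Suc p} \<times> K = {..<p} \<times> K \<union> {p} \<times> K" by auto
  let ?c = "iexp (s * ln 2) * (Gamma (Complex (real (card K - Suc p) / 2) s) / Gamma (of_real (real (card K - Suc p) / 2)))"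
  have inner: "(\<integral> y. h (Suc p) (merge ({..<p} \<times> K) ({p} \<times> K) (x, y)) \<partial>std_gaussian ({p} \<times> K)) = h p x * ?c"
    if x: "x \<in> space (std_gaussian ({..<p} \<times> K))" for x
  proof (cases "\<forall>q\<le>p. gram_det K q x > 0")
    case True
    obtain e where e: "orthonormal_on ({p} \<times> K) (Suc p) e"
      "\<And>y. gram_det K (Suc p) (merge ({..<p} \<times> K) ({p} \<times> K) (x, y)) = gram_det K p x * residual_square ({p} \<times> K) (Suc p) e y"
      using gram_det_new_column[OF K K0, of p x] True by blast
    have fin: "finite ({p} \<times> K)" and crd: "Suc p < card ({p} \<times> K)" "card ({p} \<times> K) = card K"
      using K Suc.prems by (auto simp: card_cartesian_product_singleton)
    note rl = residual_square_log_char[OF fin e(1) crd(1), unfolded crd(2)]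
    have eq: "gram_det K q (merge ({..<p} \<times> K) ({p} \<times> K) (x, y)) = gram_det K q x" if "q \<le> p" for q y
      using that by (intro gram_det_cong) (auto simp: merge_def)
    have D: "gram_det K p x > 0" using True by simp
    have "(\<integral> y. h (Suc p) (merge ({..<p} \<times> K) ({p} \<times> K) (x, y)) \<partial>std_gaussian ({p} \<times> K))
       = (\<integral> y. h p x * iexp (s * ln (residual_square ({p} \<times> K) (Suc p) e y)) \<partial>std_gaussian ({p} \<times> K))"
    proof (rule integral_cong_AE)
      show "AE y in std_gaussian ({p} \<times> K). h (Suc p) (merge ({..<p} \<times> K) ({p} \<times> K) (x, y)) = h p x * iexp (s * ln (residual_square ({p} \<times> K) (Suc p) e y))"
        using rl(1)
      proof eventually_elim
        case (elim y)
        have "\<forall>q\<le>Suc p. gram_det K q (merge ({..<p} \<times> K) ({p} \<times> K) (x, y)) > 0"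
          using True eq e(2)[of y] D elim by (auto simp: le_Suc_eq)
        then show ?case using True D elim unfolding h_def e(2)
          by (simp add: ln_mult_pos exp_add[symmetric] algebra_simps)
      qed
      show "(\<lambda>y. h (Suc p) (merge ({..<p} \<times> K) ({p} \<times> K) (x, y))) \<in> borel_measurable (std_gaussian ({p} \<times> K))"
        by (rule measurable_compose[OF measurable_Pair1'[OF x] measurable_compose[OF measurable_merge meas]]) auto
    qed measurable
    also have "\<dots> = h p x * ?c" using rl(2)[of s] by simp
    finally show ?thesis .
  next
    case False
    then obtain q where q: "q \<le> p" "\<not> gram_det K q x > 0" by auto
    have "gram_det K q (merge ({..<p} \<times> K) ({p} \<times> K) (x, y)) = gram_det K q x" for y
      using q by (intro gram_det_cong) (auto simp: merge_def)
    then have "h (Suc p) (merge ({..<p} \<times> K) ({p} \<times> K) (x, y)) = 0" for y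
      using q by (auto simp: h_def intro!: exI[of _ q])
    moreover have "h p x = 0" using False by (auto simp: h_def)
    ultimately show ?thesis by simp
  qed
  have "(\<integral> z. h (Suc p) z \<partial>std_gaussian ({..<Suc p} \<times> K)) = (\<integral> x. (\<integral> y. h (Suc p) (merge ({..<p} \<times> K) ({p} \<times> K) (x, y)) \<partial>std_gaussian ({p} \<times> K)) \<partial>std_gaussian ({..<p} \<times> K))"
    unfolding split
  proof (rule P.product_integral_fold)
    show "integrable (std_gaussian ({..<p} \<times> K \<union> {p} \<times> K)) (h (Suc p))"
      unfolding split[symmetric] by (rule IJ.integrable_const_bound[of _ 1]) (use hb meas in auto)
  qed (use K in auto)
  also have "\<dots> = (\<integral> x. h p x * ?c \<partial>std_gaussian ({..<p} \<times> K))"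
    by (intro Bochner_Integration.integral_cong inner refl)
  also have "\<dots> = (\<integral> x. h p x \<partial>std_gaussian ({..<p} \<times> K)) * ?c" by simp
  also have "\<dots> = (\<Prod>j<Suc p. iexp (s * ln 2) * (Gamma (Complex (real (card K - Suc j) / 2) s) / Gamma (of_real (real (card K - Suc j) / 2))))"
    using Suc by simp
  finally show ?case .
qed

text \<open>
  At \<open>s = 0\<close> all factors of the preceding product formula are 1.
\<close>

lemma gram_det_positive:
  fixes K :: "'k set"
  assumes K: "finite K" and p: "p < card K"
  shows "AE z in std_gaussian ({..<p} \<times> K). \<forall>q\<le>p. gram_det K q z > 0"
proof -
  let ?P = "std_gaussian ({..<p} \<times> K)"
  interpret prob_space ?P by (rule prob_space_std_gaussian)
  have [measurable]: "gram_det K r \<in> borel_measurable ?P" if "r \<le> p" for r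
    unfolding measurable_cong_sets[OF sets_std_gaussian refl]
    by (rule measurable_gram_det) (use that in auto)
  have "Measurable.pred ?P (\<lambda>z. \<forall>r\<in>{..p}. gram_det K r z > 0)"
    by (intro pred_intros_finite) auto
  then have [measurable]: "Measurable.pred ?P (\<lambda>z. \<forall>r\<le>p. gram_det K r z > 0)" by simp
  let ?A = "{z \<in> space ?P. \<forall>q\<le>p. gram_det K q z > 0}"
  have "complex_of_real (prob ?A) = (\<integral> z. complex_of_real (indicator ?A z) \<partial>?P)"
    by simp
  also have "\<dots> = (\<integral> z. (if \<forall>q\<le>p. gram_det K q z > 0 then iexp (0 * ln (gram_det K p z)) else 0) \<partial>?P)"
    by (intro Bochner_Integration.integral_cong refl) (auto simp: indicator_def)
  also have "\<dots> = (\<Prod>j<p. iexp (0 * ln 2) * (Gamma (Complex (real (card K - Suc j) / 2) 0) / Gamma (of_real (real (card K - Suc j) / 2))))"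
    by (rule gram_det_log_char_nondegenerate[OF K p])
  also have "\<dots> = 1"
  proof (rule prod.neutral, safe)
    fix j assume "j < p"
    then have "Gamma (complex_of_real (real (card K - Suc j) / 2)) \<noteq> 0"
      using p by (subst Gamma_complex_of_real) (simp add: Gamma_real_pos less_imp_neq[symmetric])
    then show "iexp (0 * ln 2) * (Gamma (Complex (real (card K - Suc j) / 2) 0) / Gamma (complex_of_real (real (card K - Suc j) / 2))) = 1"
      unfolding complex_of_real_def[of "real (card K - Suc j) / 2", symmetric] by simp
  qed
  finally have "prob ?A = 1" by simp
  then have "AE z in ?P. z \<in> ?A" by (intro prob_eq_1[THEN iffD1]) auto
  then show ?thesis by eventually_elim auto
qed

lemma gram_det_log_char:
  fixes K :: "'k set" and s :: real
  assumes K: "finite K" and p: "p < card K"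
  shows "(\<integral> z. iexp (s * ln (gram_det K p z)) \<partial>std_gaussian ({..<p} \<times> K))
    = (\<Prod>j<p. iexp (s * ln 2) * (Gamma (Complex (real (card K - Suc j) / 2) s) / Gamma (of_real (real (card K - Suc j) / 2))))"
proof -
  let ?P = "std_gaussian ({..<p} \<times> K)"
  have [measurable]: "gram_det K r \<in> borel_measurable ?P" if "r \<le> p" for r
    unfolding measurable_cong_sets[OF sets_std_gaussian refl]
    by (rule measurable_gram_det) (use that in auto)
  have "Measurable.pred ?P (\<lambda>z. \<forall>r\<in>{..p}. gram_det K r z > 0)"
    by (intro pred_intros_finite) auto
  then have [measurable]: "Measurable.pred ?P (\<lambda>z. \<forall>r\<le>p. gram_det K r z > 0)" by simp
  have "(\<integral> z. iexp (s * ln (gram_det K p z)) \<partial>?P)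
      = (\<integral> z. (if \<forall>q\<le>p. gram_det K q z > 0 then iexp (s * ln (gram_det K p z)) else 0) \<partial>?P)"
    by (rule integral_cong_AE) (use gram_det_positive[OF K p] in auto)
  then show ?thesis using gram_det_log_char_nondegenerate[OF K p, of s] by simp
qed

section \<open>Cholesky factors and triangular changes of variables\<close>

text \<open>
  Elimination of the first variable: the Schur complement of \<open>a 0 0\<close> is again positive definite, since its
  quadratic form at \<open>v\<close> is that of \<open>a\<close> at \<open>v\<close> extended by the minimizing value of the first variable.
\<close>

lemma cholesky_exists:
  fixes a :: "nat \<Rightarrow> nat \<Rightarrow> real"
  assumes "\<And>i j. i < p \<Longrightarrow> j < p \<Longrightarrow> a i j = a j i"
    and "\<And>v. \<exists>i<p. v i \<noteq> 0 \<Longrightarrow> (\<Sum>i<p. \<Sum>j<p. a i j * v i * v j) > 0"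
  shows "\<exists>l. (\<forall>i<p. l i i > 0) \<and> (\<forall>i j. i < j \<longrightarrow> l i j = 0) \<and> (\<forall>i<p. \<forall>j<p. a i j = (\<Sum>k<p. l i k * l j k))"
  using assms
proof (induction p arbitrary: a)
  case 0
  show ?case by (rule exI[of _ "\<lambda>_ _. 0"]) auto
next
  case (Suc p)
  define s where "s = a 0 0"
  have s: "s > 0"
  proof -
    have "(\<Sum>i<Suc p. \<Sum>j<Suc p. a i j * (if i = 0 then 1 else 0) * (if j = 0 then 1 else 0)) > 0"
      by (rule Suc.prems(2)) auto
    then show ?thesis by (simp add: sum.lessThan_Suc_shift s_def del: sum.lessThan_Suc)
  qed
  define b where "b i = a (Suc i) 0" for i
  have b': "a 0 (Suc i) = b i" if "i < p" for i using Suc.prems(1)[of 0 "Suc i"] that by (simp add: b_def)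
  define a' where "a' i j = a (Suc i) (Suc j) - b i * b j / s" for i j
  have "\<exists>l. (\<forall>i<p. l i i > 0) \<and> (\<forall>i j. i < j \<longrightarrow> l i j = 0) \<and> (\<forall>i<p. \<forall>j<p. a' i j = (\<Sum>k<p. l i k * l j k))"
  proof (rule Suc.IH)
    show "a' i j = a' j i" if "i < p" "j < p" for i j
      using Suc.prems(1)[of "Suc i" "Suc j"] that by (simp add: a'_def)
    fix v :: "nat \<Rightarrow> real" assume v: "\<exists>i<p. v i \<noteq> 0"
    define B where "B = (\<Sum>i<p. b i * v i)"
    \<comment> \<open>The value - B / s of the first variable minimizes the quadratic form for given remaining variables v.\<close>
    define u where "u i = (case i of 0 \<Rightarrow> - B / s | Suc i \<Rightarrow> v i)" for i
    have "(\<Sum>i<Suc p. \<Sum>j<Suc p. a i j * u i * u j) > 0"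
    proof (rule Suc.prems(2))
      from v obtain i where "i < p" "v i \<noteq> 0" by blast
      then show "\<exists>i<Suc p. u i \<noteq> 0" by (intro exI[of _ "Suc i"]) (simp add: u_def)
    qed
    also have "(\<Sum>i<Suc p. \<Sum>j<Suc p. a i j * u i * u j)
       = (s * u 0 * u 0 + B * u 0) + (B * u 0 + (\<Sum>i<p. \<Sum>j<p. a (Suc i) (Suc j) * v i * v j))"
    proof -
      have "(\<Sum>j<p. a 0 (Suc j) * u 0 * u (Suc j)) = B * u 0"
        unfolding B_def sum_distrib_right by (intro sum.cong refl) (simp add: b' u_def)
      then have r0: "(\<Sum>j<Suc p. a 0 j * u 0 * u j) = s * u 0 * u 0 + B * u 0"
        unfolding sum.lessThan_Suc_shift by (simp add: s_def)
      have r1: "(\<Sum>j<Suc p. a (Suc i) j * u (Suc i) * u j) = b i * v i * u 0 + (\<Sum>j<p. a (Suc i) (Suc j) * v i * v j)" for i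
        unfolding sum.lessThan_Suc_shift by (simp add: b_def u_def)
      show ?thesis
        unfolding sum.lessThan_Suc_shift[of _ p, where g = "\<lambda>i. \<Sum>j<Suc p. a i j * u i * u j"] r0 r1
        by (simp only: sum.distrib sum_distrib_right[symmetric] B_def)
    qed
    also have "\<dots> = (\<Sum>i<p. \<Sum>j<p. a (Suc i) (Suc j) * v i * v j) - B * B / s"
      using s by (simp add: u_def field_simps)
    also have "B * B / s = (\<Sum>i<p. \<Sum>j<p. b i * b j / s * v i * v j)"
      by (simp add: B_def sum_product sum_divide_distrib mult_ac)
    also have "(\<Sum>i<p. \<Sum>j<p. a (Suc i) (Suc j) * v i * v j) - \<dots> = (\<Sum>i<p. \<Sum>j<p. a' i j * v i * v j)"
      by (simp add: a'_def sum_subtractf left_diff_distrib)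
    finally show "(\<Sum>i<p. \<Sum>j<p. a' i j * v i * v j) > 0" .
  qed
  then obtain l where l: "\<And>i. i < p \<Longrightarrow> l i i > 0" "\<And>i j. i < j \<Longrightarrow> l i j = 0"
    "\<And>i j. i < p \<Longrightarrow> j < p \<Longrightarrow> a' i j = (\<Sum>k<p. l i k * l j k)" by blast
  define l' where "l' i j = (case i of 0 \<Rightarrow> (case j of 0 \<Rightarrow> sqrt s | Suc j \<Rightarrow> 0)
     | Suc i \<Rightarrow> (case j of 0 \<Rightarrow> b i / sqrt s | Suc j \<Rightarrow> l i j))" for i j
  have "l' i i > 0" if "i < Suc p" for i using that l(1) s by (auto simp: l'_def split: nat.split)
  moreover have "l' i j = 0" if "i < j" for i j using that l(2) by (auto simp: l'_def split: nat.split)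
  moreover have "a i j = (\<Sum>k<Suc p. l' i k * l' j k)" if "i < Suc p" "j < Suc p" for i j
    using that s l(3)[symmetric] unfolding sum.lessThan_Suc_shift
    by (cases i; cases j) (simp_all add: l'_def s_def[symmetric] b_def[symmetric] b' a'_def)
  ultimately show ?case by blast
qed

text \<open>
  Only the diagonal and the entries below it are read, so that truncating \<open>p\<close> truncates the map.
\<close>

definition triangular_affine :: "nat \<Rightarrow> (nat \<Rightarrow> real) \<Rightarrow> (nat \<Rightarrow> nat \<Rightarrow> real) \<Rightarrow> (nat \<Rightarrow> real) \<Rightarrow> nat \<Rightarrow> real" where
  "triangular_affine p m l z = (\<lambda>i\<in>{..<p}. m i + (\<Sum>j<Suc i. l i j * z j))"

lemma measurable_triangular_affine [measurable]:
  "triangular_affine p m l \<in> measurable (PiM {..<p} (\<lambda>_. borel)) (PiM {..<p} (\<lambda>_. borel))"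
  unfolding triangular_affine_def[abs_def]
proof (rule measurable_restrict)
  fix i assume "i \<in> {..<p}"
  then have [measurable]: "(\<lambda>z. z j) \<in> borel_measurable (PiM {..<p} (\<lambda>_. borel))" if "j < Suc i" for j
    using that by (intro measurable_component_singleton) auto
  show "(\<lambda>z. m i + (\<Sum>j<Suc i. l i j * z j)) \<in> borel_measurable (PiM {..<p} (\<lambda>_. borel))"
    by (intro borel_measurable_add borel_measurable_sum borel_measurable_times) auto
qed

lemma product_sigma_finite_lborel: "product_sigma_finite (\<lambda>_::'i. lborel :: real measure)"
  by (simp add: product_sigma_finite_def sigma_finite_lborel)

lemma sets_PiM_lborel [measurable_cong]: "sets (PiM I (\<lambda>_. lborel :: real measure)) = sets (PiM I (\<lambda>_. borel))"
  by (intro sets_PiM_cong) auto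

text \<open>
  Integrated over the last coordinate first, the map acts on that coordinate as a one-dimensional affine
  map whose slope is the last diagonal entry.
\<close>

lemma nn_integral_triangular_affine:
  fixes f :: "(nat \<Rightarrow> real) \<Rightarrow> ennreal"
  assumes "f \<in> borel_measurable (PiM {..<p} (\<lambda>_. borel))" and l: "\<And>i. i < p \<Longrightarrow> l i i > 0"
  shows "(\<integral>\<^sup>+ x. f x \<partial>PiM {..<p} (\<lambda>_. lborel))
    = ennreal (\<Prod>i<p. l i i) * (\<integral>\<^sup>+ z. f (triangular_affine p m l z) \<partial>PiM {..<p} (\<lambda>_. lborel))"
  using assms
proof (induction p arbitrary: f)
  case 0
  interpret P: product_sigma_finite "\<lambda>_::nat. lborel :: real measure" by (rule product_sigma_finite_lborel)
  show ?case by (simp add: PiM_empty nn_integral_count_space_finite triangular_affine_def restrict_def)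
next
  case (Suc p)
  interpret P: product_sigma_finite "\<lambda>_::nat. lborel :: real measure" by (rule product_sigma_finite_lborel)
  have f[measurable]: "f \<in> borel_measurable (PiM (insert p {..<p}) (\<lambda>_. borel))"
    using Suc.prems(1) by (simp add: lessThan_Suc)
  have T[measurable]: "triangular_affine (Suc p) m l \<in> measurable (PiM (insert p {..<p}) (\<lambda>_. borel)) (PiM (insert p {..<p}) (\<lambda>_. borel))"
    using measurable_triangular_affine[of "Suc p" m l] by (simp add: lessThan_Suc)
  define g where "g x = (\<integral>\<^sup>+ y. f (x(p := y)) \<partial>lborel)" for x
  have g[measurable]: "g \<in> borel_measurable (PiM {..<p} (\<lambda>_. borel))"
    unfolding g_def by measurable
  have pos: "\<And>i. i < p \<Longrightarrow> l i i > 0" "l p p > 0" using Suc.prems(2) by auto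
  have upd: "(triangular_affine p m l z)(p := (m p + (\<Sum>j<p. l p j * z j)) + l p p * y) = triangular_affine (Suc p) m l (z(p := y))" for z y
    by (auto simp: triangular_affine_def fun_eq_iff restrict_def less_Suc_eq intro!: sum.cong)
  have "(\<integral>\<^sup>+ x. f x \<partial>PiM {..<Suc p} (\<lambda>_. lborel)) = (\<integral>\<^sup>+ x. g x \<partial>PiM {..<p} (\<lambda>_. lborel))"
    unfolding lessThan_Suc g_def by (rule P.product_nn_integral_insert) auto
  also have "\<dots> = ennreal (\<Prod>i<p. l i i) * (\<integral>\<^sup>+ z. g (triangular_affine p m l z) \<partial>PiM {..<p} (\<lambda>_. lborel))"
    by (rule Suc.IH[OF g pos(1)])
  also have "(\<integral>\<^sup>+ z. g (triangular_affine p m l z) \<partial>PiM {..<p} (\<lambda>_. lborel))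
     = (\<integral>\<^sup>+ z. ennreal (l p p) * (\<integral>\<^sup>+ y. f (triangular_affine (Suc p) m l (z(p := y))) \<partial>lborel) \<partial>PiM {..<p} (\<lambda>_. lborel))"
  proof (rule nn_integral_cong)
    fix z assume "z \<in> space (PiM {..<p} (\<lambda>_. lborel :: real measure))"
    have sp: "triangular_affine p m l z \<in> space (PiM {..<p} (\<lambda>_. borel :: real measure))"
      by (simp add: space_PiM triangular_affine_def)
    have "(\<lambda>y. f ((triangular_affine p m l z)(p := y))) \<in> borel_measurable borel"
      using measurable_compose[OF measurable_component_update[OF sp, of p] f] by simp
    from nn_integral_real_affine[OF this, of "l p p" "m p + (\<Sum>j<p. l p j * z j)"] pos(2)
    show "g (triangular_affine p m l z) = ennreal (l p p) * (\<integral>\<^sup>+ y. f (triangular_affine (Suc p) m l (z(p := y))) \<partial>lborel)"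
      unfolding g_def upd by simp
  qed
  also have "\<dots> = ennreal (l p p) * (\<integral>\<^sup>+ z. (\<integral>\<^sup>+ y. f (triangular_affine (Suc p) m l (z(p := y))) \<partial>lborel) \<partial>PiM {..<p} (\<lambda>_. lborel))"
    by (rule nn_integral_cmult) measurable
  also have "(\<integral>\<^sup>+ z. (\<integral>\<^sup>+ y. f (triangular_affine (Suc p) m l (z(p := y))) \<partial>lborel) \<partial>PiM {..<p} (\<lambda>_. lborel))
     = (\<integral>\<^sup>+ z. f (triangular_affine (Suc p) m l z) \<partial>PiM {..<Suc p} (\<lambda>_. lborel))"
    unfolding lessThan_Suc by (rule P.product_nn_integral_insert[symmetric]) auto
  finally have "(\<integral>\<^sup>+ x. f x \<partial>PiM {..<Suc p} (\<lambda>_. lborel)) = (ennreal (\<Prod>i<p. l i i) * ennreal (l p p))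
      * (\<integral>\<^sup>+ z. f (triangular_affine (Suc p) m l z) \<partial>PiM {..<Suc p} (\<lambda>_. lborel))"
    by (simp only: mult.assoc)
  moreover have "ennreal (\<Prod>i<p. l i i) * ennreal (l p p) = ennreal (\<Prod>i<Suc p. l i i)"
    using pos by (subst ennreal_mult[symmetric]) (auto intro!: prod_pos less_imp_le)
  ultimately show ?case by (simp only:)
qed

lemma std_gaussian_eq_density:
  assumes I: "finite I"
  shows "std_gaussian I = density (PiM I (\<lambda>_. lborel)) (\<lambda>z. \<Prod>i\<in>I. ennreal (std_normal_density (z i)))"
proof -
  interpret L: product_sigma_finite "\<lambda>_::'a. lborel :: real measure" by (rule product_sigma_finite_lborel)
  interpret N: product_sigma_finite "\<lambda>_::'a. std_normal_distribution" by (rule product_sigma_finite_std_normal)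
  have "density (PiM I (\<lambda>_. lborel)) (\<lambda>z. \<Prod>i\<in>I. ennreal (std_normal_density (z i))) = std_gaussian I"
  proof (rule N.PiM_eqI[OF I])
    show "sets (density (PiM I (\<lambda>_. lborel)) (\<lambda>z. \<Prod>i\<in>I. ennreal (std_normal_density (z i)))) = sets (std_gaussian I)"
      by (simp add: sets_PiM_lborel sets_std_gaussian)
    fix A :: "'a \<Rightarrow> real set" assume A: "\<And>i. i \<in> I \<Longrightarrow> A i \<in> sets std_normal_distribution"
    have [measurable]: "A i \<in> sets borel" if "i \<in> I" for i using A[OF that] by simp
    have "Pi\<^sub>E I A \<in> sets (PiM I (\<lambda>_. lborel))"
      using A by (intro sets_PiM_I_finite[OF I]) auto
    then have "emeasure (density (PiM I (\<lambda>_. lborel)) (\<lambda>z. \<Prod>i\<in>I. ennreal (std_normal_density (z i)))) (Pi\<^sub>E I A)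
       = (\<integral>\<^sup>+ z. (\<Prod>i\<in>I. ennreal (std_normal_density (z i))) * indicator (Pi\<^sub>E I A) z \<partial>PiM I (\<lambda>_. lborel))"
      by (subst emeasure_density) auto
    also have "\<dots> = (\<integral>\<^sup>+ z. (\<Prod>i\<in>I. ennreal (std_normal_density (z i)) * indicator (A i) (z i)) \<partial>PiM I (\<lambda>_. lborel))"
    proof (rule nn_integral_cong)
      fix z assume "z \<in> space (PiM I (\<lambda>_. lborel :: real measure))"
      then have "indicator (Pi\<^sub>E I A) z = (\<Prod>i\<in>I. indicator (A i) (z i) :: ennreal)"
        using I by (auto simp: indicator_def space_PiM PiE_iff prod_zero_iff)
      then show "(\<Prod>i\<in>I. ennreal (std_normal_density (z i))) * indicator (Pi\<^sub>E I A) z = (\<Prod>i\<in>I. ennreal (std_normal_density (z i)) * indicator (A i) (z i))"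
        by (simp add: prod.distrib)
    qed
    also have "\<dots> = (\<Prod>i\<in>I. \<integral>\<^sup>+ x. ennreal (std_normal_density x) * indicator (A i) x \<partial>lborel)"
      by (rule L.product_nn_integral_prod[OF I]) auto
    also have "\<dots> = (\<Prod>i\<in>I. emeasure std_normal_distribution (A i))"
      by (intro prod.cong refl, subst emeasure_density) auto
    finally show "emeasure (density (PiM I (\<lambda>_. lborel)) (\<lambda>z. \<Prod>i\<in>I. ennreal (std_normal_density (z i)))) (Pi\<^sub>E I A)
       = (\<Prod>i\<in>I. emeasure std_normal_distribution (A i))" .
  qed
  then show ?thesis ..
qed

lemma inverse_mat_exists:
  fixes A :: "real mat"
  assumes A: "A \<in> carrier_mat p p" and d: "det A \<noteq> 0"
  shows "A * the (mat_inverse A) = 1\<^sub>m p" "the (mat_inverse A) * A = 1\<^sub>m p" "the (mat_inverse A) \<in> carrier_mat p p"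
proof -
  have "mat_inverse A \<noteq> None"
    using mat_inverse(1)[OF A, of "()"] det_non_zero_imp_unit[OF A d, of "()"] by auto
  then obtain B where "mat_inverse A = Some B" by auto
  then show "A * the (mat_inverse A) = 1\<^sub>m p" "the (mat_inverse A) * A = 1\<^sub>m p" "the (mat_inverse A) \<in> carrier_mat p p"
    using mat_inverse(2)[OF A] by auto
qed

text \<open>
  \<open>L\<^sup>T \<Sigma>\<^sup>-\<^sup>1 L\<close> is the identity, as one sees after multiplying it by \<open>L\<close> from the left.
\<close>

lemma quadratic_form_whitened:
  fixes L \<Sigma> :: "real mat" and z :: "real vec"
  assumes L: "L \<in> carrier_mat p p" "det L \<noteq> 0" and \<Sigma>: "\<Sigma> = L * transpose_mat L" and z: "z \<in> carrier_vec p"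
  shows "scalar_prod (L *\<^sub>v z) (the (mat_inverse \<Sigma>) *\<^sub>v (L *\<^sub>v z)) = scalar_prod z z"
proof -
  define B where "B = the (mat_inverse \<Sigma>)"
  define C where "C = the (mat_inverse L)"
  have LT: "transpose_mat L \<in> carrier_mat p p" using L by simp
  have S: "\<Sigma> \<in> carrier_mat p p" unfolding \<Sigma> using L(1) LT by (rule mult_carrier_mat)
  have "det \<Sigma> \<noteq> 0" unfolding \<Sigma> using L det_mult[OF L(1) LT] det_transpose[OF L(1)] by simp
  note B = inverse_mat_exists[OF S this, folded B_def]
  note C = inverse_mat_exists[OF L, folded C_def]
  have BL: "B * L \<in> carrier_mat p p" using B(3) L(1) by (rule mult_carrier_mat)
  have X: "transpose_mat L * (B * L) \<in> carrier_mat p p" using LT BL by (rule mult_carrier_mat)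
  have "L * (transpose_mat L * (B * L)) = \<Sigma> * (B * L)"
    unfolding \<Sigma> by (rule assoc_mult_mat[OF L(1) LT BL, symmetric])
  also have "\<dots> = (\<Sigma> * B) * L" by (rule assoc_mult_mat[OF S B(3) L(1), symmetric])
  also have "\<dots> = L" using B(1) L(1) by simp
  finally have e: "L * (transpose_mat L * (B * L)) = L" .
  have "transpose_mat L * (B * L) = (C * L) * (transpose_mat L * (B * L))" unfolding C(2) by (rule left_mult_one_mat[OF X, symmetric])
  also have "\<dots> = C * (L * (transpose_mat L * (B * L)))" by (rule assoc_mult_mat[OF C(3) L(1) X])
  also have "\<dots> = 1\<^sub>m p" unfolding e by (rule C(2))
  finally have one: "transpose_mat L * (B * L) = 1\<^sub>m p" .
  have Lz: "L *\<^sub>v z \<in> carrier_vec p" using L(1) z by simp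
  have BLz: "B *\<^sub>v (L *\<^sub>v z) \<in> carrier_vec p" using B(3) Lz by simp
  have "scalar_prod (L *\<^sub>v z) (B *\<^sub>v (L *\<^sub>v z)) = scalar_prod (B *\<^sub>v (L *\<^sub>v z)) (L *\<^sub>v z)"
    using Lz BLz by (rule comm_scalar_prod)
  also have "\<dots> = scalar_prod (transpose_mat L *\<^sub>v (B *\<^sub>v (L *\<^sub>v z))) z"
    by (rule transpose_vec_mult_scalar[OF L(1) z BLz, symmetric])
  also have "transpose_mat L *\<^sub>v (B *\<^sub>v (L *\<^sub>v z)) = (transpose_mat L * (B * L)) *\<^sub>v z"
    using assoc_mult_mat_vec[OF LT BL z] assoc_mult_mat_vec[OF B(3) L(1) z] by simp
  also have "\<dots> = z" unfolding one using z by simp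
  finally show ?thesis by (simp add: B_def)
qed

section \<open>Normal samples as images of Gaussian arrays\<close>

lemma positive_definite_cholesky:
  assumes "positive_definite_mat p \<Sigma>"
  obtains l where "\<And>i. i < p \<Longrightarrow> l i i > 0" "\<And>i j. i < j \<Longrightarrow> l i j = 0"
    "\<Sigma> = mat p p (\<lambda>(i, j). l i j) * transpose_mat (mat p p (\<lambda>(i, j). l i j))"
proof -
  have \<Sigma>: "\<Sigma> \<in> carrier_mat p p" "transpose_mat \<Sigma> = \<Sigma>"
    and pos: "\<And>v. v \<in> carrier_vec p \<Longrightarrow> v \<noteq> 0\<^sub>v p \<Longrightarrow> scalar_prod v (\<Sigma> *\<^sub>v v) > 0"
    using assms by (auto simp: positive_definite_mat_def)
  have "\<exists>l. (\<forall>i<p. l i i > 0) \<and> (\<forall>i j. i < j \<longrightarrow> l i j = 0) \<and> (\<forall>i<p. \<forall>j<p. \<Sigma> $$ (i, j) = (\<Sum>k<p. l i k * l j k))"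
  proof (rule cholesky_exists)
    show "\<Sigma> $$ (i, j) = \<Sigma> $$ (j, i)" if "i < p" "j < p" for i j
      using \<Sigma>(1) that by (subst \<Sigma>(2)[symmetric]) simp
    fix v :: "nat \<Rightarrow> real" assume "\<exists>i<p. v i \<noteq> 0"
    then obtain i where i: "i < p" "v i \<noteq> 0" by blast
    then have "vec p v $ i \<noteq> 0\<^sub>v p $ i" by simp
    then have "vec p v \<noteq> 0\<^sub>v p" by metis
    then have "scalar_prod (vec p v) (\<Sigma> *\<^sub>v vec p v) > 0" by (intro pos) auto
    also have "scalar_prod (vec p v) (\<Sigma> *\<^sub>v vec p v) = (\<Sum>i<p. \<Sum>j<p. \<Sigma> $$ (i, j) * v i * v j)"
      using \<Sigma>(1) by (simp add: scalar_prod_def lessThan_atLeast0 sum_distrib_left mult_ac)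
    finally show "(\<Sum>i<p. \<Sum>j<p. \<Sigma> $$ (i, j) * v i * v j) > 0" .
  qed
  then obtain l where l: "\<And>i. i < p \<Longrightarrow> l i i > 0" "\<And>i j. i < j \<Longrightarrow> l i j = 0"
    "\<And>i j. i < p \<Longrightarrow> j < p \<Longrightarrow> \<Sigma> $$ (i, j) = (\<Sum>k<p. l i k * l j k)" by blast
  have "\<Sigma> = mat p p (\<lambda>(i, j). \<Sigma> $$ (i, j))" using \<Sigma>(1) by (intro eq_matI) auto
  also have "\<dots> = mat p p (\<lambda>(i, j). \<Sum>k<p. l i k * l j k)" using l(3) by (intro cong_mat) auto
  finally show ?thesis using l(1,2) that unfolding mat_mult_transpose_fun by blast
qed

lemma sum_lower_triangular:
  fixes l :: "nat \<Rightarrow> nat \<Rightarrow> real"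
  assumes "\<And>i j. i < j \<Longrightarrow> l i j = 0" "i < p"
  shows "(\<Sum>j<Suc i. l i j * z j) = (\<Sum>j<p. l i j * z j)"
  by (rule sum.mono_neutral_left) (use assms in auto)

text \<open>
  The Jacobian of the affine map is \<open>sqrt (det \<Sigma>)\<close>, so it cancels this factor in the normalization of the density.
\<close>

lemma multivariate_normal_density_triangular_affine:
  fixes l :: "nat \<Rightarrow> nat \<Rightarrow> real"
  assumes l: "\<And>i. i < p \<Longrightarrow> l i i > 0" "\<And>i j. i < j \<Longrightarrow> l i j = 0"
    and \<Sigma>: "\<Sigma> = mat p p (\<lambda>(i, j). l i j) * transpose_mat (mat p p (\<lambda>(i, j). l i j))"
    and \<mu>: "\<mu> \<in> carrier_vec p"
  shows "(\<Prod>i<p. l i i) * multivariate_normal_density p \<mu> \<Sigma> (triangular_affine p (\<lambda>i. \<mu> $ i) l z)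
     = (\<Prod>i<p. std_normal_density (z i))"
proof -
  define L where "L = mat p p (\<lambda>(i, j). l i j)"
  have L: "L \<in> carrier_mat p p" by (simp add: L_def)
  have dL: "det L = (\<Prod>i<p. l i i)" unfolding L_def by (rule det_lower_triangular_fun) (use l in auto)
  have dpos: "(\<Prod>i<p. l i i) > 0" using l(1) by (intro prod_pos) auto
  have d\<Sigma>: "det \<Sigma> = (\<Prod>i<p. l i i)^2"
    unfolding \<Sigma> L_def[symmetric] using det_mult[OF L transpose_carrier_mat[THEN iffD2, OF L]] det_transpose[OF L] dL
    by (simp add: power2_eq_square)
  have x: "vec p (triangular_affine p (\<lambda>i. \<mu> $ i) l z) - \<mu> = L *\<^sub>v vec p z"
  proof (rule eq_vecI)
    fix i assume "i < dim_vec (L *\<^sub>v vec p z)"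
    then have i: "i < p" by (simp add: L_def)
    then show "(vec p (triangular_affine p (\<lambda>i. \<mu> $ i) l z) - \<mu>) $ i = (L *\<^sub>v vec p z) $ i"
      using \<mu> sum_lower_triangular[where l = l and z = z, OF l(2) i]
      by (simp add: triangular_affine_def L_def scalar_prod_def lessThan_atLeast0)
  qed (use \<mu> in \<open>auto simp: L_def\<close>)
  have "scalar_prod (L *\<^sub>v vec p z) (the (mat_inverse \<Sigma>) *\<^sub>v (L *\<^sub>v vec p z)) = scalar_prod (vec p z) (vec p z)"
    by (rule quadratic_form_whitened[OF L _ \<Sigma>[folded L_def] vec_carrier]) (use dpos dL in linarith)
  also have "\<dots> = (\<Sum>i<p. (z i)^2)" by (simp add: scalar_prod_def lessThan_atLeast0 power2_eq_square)
  finally have q: "scalar_prod (L *\<^sub>v vec p z) (the (mat_inverse \<Sigma>) *\<^sub>v (L *\<^sub>v vec p z)) = (\<Sum>i<p. (z i)^2)" .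
  have sq: "sqrt ((2 * pi) ^ p * det \<Sigma>) = sqrt (2 * pi) ^ p * (\<Prod>i<p. l i i)"
    unfolding d\<Sigma> using dpos by (simp add: real_sqrt_mult real_sqrt_power power_mult_distrib)
  have cancel: "c * (E / (S * c)) = E / S" if "c > 0" for c E S :: real using that by simp
  have "(\<Prod>i<p. l i i) * multivariate_normal_density p \<mu> \<Sigma> (triangular_affine p (\<lambda>i. \<mu> $ i) l z)
     = exp (- (\<Sum>i<p. (z i)^2) / 2) / sqrt (2 * pi) ^ p"
    unfolding multivariate_normal_density_def x q sq by (rule cancel[OF dpos])
  also have "\<dots> = (\<Prod>i<p. std_normal_density (z i))"
    by (simp add: std_normal_density_def prod_dividef exp_sum[symmetric] sum_negf[symmetric] sum_divide_distrib)
  finally show ?thesis .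
qed

lemma multivariate_normal_distr:
  fixes l :: "nat \<Rightarrow> nat \<Rightarrow> real"
  assumes X: "multivariate_normal_distributed M p X \<mu> \<Sigma>"
    and l: "\<And>i. i < p \<Longrightarrow> l i i > 0" "\<And>i j. i < j \<Longrightarrow> l i j = 0"
    and \<Sigma>: "\<Sigma> = mat p p (\<lambda>(i, j). l i j) * transpose_mat (mat p p (\<lambda>(i, j). l i j))"
    and \<mu>: "\<mu> \<in> carrier_vec p"
  shows "distr M (PiM {..<p} (\<lambda>_. borel)) X
     = distr (std_gaussian {..<p}) (PiM {..<p} (\<lambda>_. borel)) (triangular_affine p (\<lambda>i. \<mu> $ i) l)"
proof -
  define T where "T = triangular_affine p (\<lambda>i. \<mu> $ i) l"
  define f where "f x = ennreal (multivariate_normal_density p \<mu> \<Sigma> x)" for x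
  have D: "distributed M (PiM {..<p} (\<lambda>_. lborel)) X f"
    using X by (simp add: multivariate_normal_distributed_def f_def[abs_def])
  have [measurable]: "f \<in> borel_measurable (PiM {..<p} (\<lambda>_. borel))"
    using distributed_borel_measurable[OF D] by (simp add: measurable_cong_sets[OF sets_PiM_lborel refl])
  have [measurable]: "T \<in> measurable (PiM {..<p} (\<lambda>_. borel)) (PiM {..<p} (\<lambda>_. borel))"
    unfolding T_def by measurable
  have "distr M (PiM {..<p} (\<lambda>_. borel)) X = distr M (PiM {..<p} (\<lambda>_. lborel)) X"
    by (rule distr_cong) (simp_all add: sets_PiM_lborel)
  also have "\<dots> = density (PiM {..<p} (\<lambda>_. lborel)) f" by (rule distributed_distr_eq_density[OF D])
  also have "\<dots> = distr (std_gaussian {..<p}) (PiM {..<p} (\<lambda>_. borel)) T"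
  proof (rule measure_eqI)
    show "sets (density (PiM {..<p} (\<lambda>_. lborel)) f) = sets (distr (std_gaussian {..<p}) (PiM {..<p} (\<lambda>_. borel)) T)"
      by (simp add: sets_PiM_lborel)
    fix A assume "A \<in> sets (density (PiM {..<p} (\<lambda>_. lborel)) f)"
    then have A[measurable]: "A \<in> sets (PiM {..<p} (\<lambda>_. borel))" by (simp add: sets_PiM_lborel)
    have pw: "ennreal (\<Prod>i<p. l i i) * f (T z) = (\<Prod>i<p. ennreal (std_normal_density (z i)))" for z
    proof -
      have "(\<Prod>i<p. l i i) > 0" using l(1) by (intro prod_pos) auto
      moreover have eq: "(\<Prod>i<p. l i i) * multivariate_normal_density p \<mu> \<Sigma> (T z) = (\<Prod>i<p. std_normal_density (z i))"
        unfolding T_def by (rule multivariate_normal_density_triangular_affine[where l = l, OF l \<Sigma> \<mu>])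
      moreover have "(\<Prod>i<p. l i i) * multivariate_normal_density p \<mu> \<Sigma> (T z) \<ge> 0"
        unfolding eq by (intro prod_nonneg) auto
      ultimately have "multivariate_normal_density p \<mu> \<Sigma> (T z) \<ge> 0" by (metis not_le mult_pos_neg)
      then show ?thesis
        unfolding f_def using \<open>(\<Prod>i<p. l i i) > 0\<close> eq
        by (simp add: ennreal_mult[symmetric] prod_ennreal)
    qed
    have "emeasure (density (PiM {..<p} (\<lambda>_. lborel)) f) A = (\<integral>\<^sup>+ x. f x * indicator A x \<partial>PiM {..<p} (\<lambda>_. lborel))"
      by (rule emeasure_density) measurable
    also have "\<dots> = ennreal (\<Prod>i<p. l i i) * (\<integral>\<^sup>+ z. f (T z) * indicator A (T z) \<partial>PiM {..<p} (\<lambda>_. lborel))"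
      unfolding T_def by (rule nn_integral_triangular_affine) (use l(1) in measurable)
    also have "\<dots> = (\<integral>\<^sup>+ z. ennreal (\<Prod>i<p. l i i) * (f (T z) * indicator A (T z)) \<partial>PiM {..<p} (\<lambda>_. lborel))"
      by (rule nn_integral_cmult[symmetric]) measurable
    also have "\<dots> = (\<integral>\<^sup>+ z. (\<Prod>i<p. ennreal (std_normal_density (z i))) * indicator A (T z) \<partial>PiM {..<p} (\<lambda>_. lborel))"
      by (simp only: mult.assoc[symmetric] pw)
    also have "\<dots> = (\<integral>\<^sup>+ z. indicator A (T z) \<partial>std_gaussian {..<p})"
      unfolding std_gaussian_eq_density[OF finite_lessThan] by (rule nn_integral_density[symmetric]) measurable
    also have "\<dots> = (\<integral>\<^sup>+ x. indicator A x \<partial>distr (std_gaussian {..<p}) (PiM {..<p} (\<lambda>_. borel)) T)"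
      by (rule nn_integral_distr[symmetric]) measurable
    also have "\<dots> = emeasure (distr (std_gaussian {..<p}) (PiM {..<p} (\<lambda>_. borel)) T) A"
      by (rule nn_integral_indicator) simp
    finally show "emeasure (density (PiM {..<p} (\<lambda>_. lborel)) f) A = emeasure (distr (std_gaussian {..<p}) (PiM {..<p} (\<lambda>_. borel)) T) A" .
  qed
  finally show ?thesis by (simp add: T_def)
qed

definition gaussian_row :: "nat \<Rightarrow> (nat \<Rightarrow> real) \<Rightarrow> (nat \<Rightarrow> nat \<Rightarrow> real) \<Rightarrow> 'k \<Rightarrow> (nat \<times> 'k \<Rightarrow> real) \<Rightarrow> nat \<Rightarrow> real" where
  "gaussian_row p m l k z = triangular_affine p m l (\<lambda>j\<in>{..<p}. z (j, k))"

text \<open>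
  The rows of the array are functions of disjoint sets of independent coordinates.
\<close>

lemma gaussian_rows_indep:
  fixes K :: "'k set"
  assumes K: "finite K" "K \<noteq> {}" and p: "p \<ge> 1"
  shows "prob_space.indep_vars (std_gaussian ({..<p} \<times> K)) (\<lambda>_. PiM {..<p} (\<lambda>_. borel)) (gaussian_row p m l) K"
proof -
  let ?I = "{..<p} \<times> K"
  interpret prob_space "std_gaussian ?I" by (rule prob_space_std_gaussian)
  have I: "?I \<noteq> {}" using K p by (auto simp: lessThan_empty_iff)
  have coords: "indep_vars (\<lambda>_. std_normal_distribution) (\<lambda>i z. z i) ?I"
  proof (subst indep_vars_iff_distr_eq_PiM'[OF I])
    show "random_variable std_normal_distribution (\<lambda>z. z i)" if "i \<in> ?I" for i
      using that by (rule measurable_component_singleton)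
    have "distr (std_gaussian ?I) (std_gaussian ?I) (\<lambda>x. \<lambda>i\<in>?I. x i) = distr (std_gaussian ?I) (std_gaussian ?I) (\<lambda>x. x)"
      by (rule distr_cong) (auto simp: space_PiM PiE_restrict)
    also have "\<dots> = std_gaussian ?I" by simp
    also have "\<dots> = PiM ?I (\<lambda>i. distr (std_gaussian ?I) std_normal_distribution (\<lambda>x. x i))"
      by (rule PiM_cong) (simp_all add: distr_PiM_component[where M = "\<lambda>_. std_normal_distribution"] prob_space_std_normal)
    finally show "distr (std_gaussian ?I) (std_gaussian ?I) (\<lambda>x. \<lambda>i\<in>?I. x i) = PiM ?I (\<lambda>i. distr (std_gaussian ?I) std_normal_distribution (\<lambda>x. x i))" .
  qed
  have "indep_vars (\<lambda>k. std_gaussian ({..<p} \<times> {k})) (\<lambda>k z. restrict (\<lambda>i. z i) ({..<p} \<times> {k})) K"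
    by (rule indep_vars_restrict[OF coords]) (auto simp: disjoint_family_on_def)
  then have "indep_vars (\<lambda>_. PiM {..<p} (\<lambda>_. borel)) (\<lambda>k z. gaussian_row p m l k (restrict (\<lambda>i. z i) ({..<p} \<times> {k}))) K"
  proof (rule indep_vars_compose2)
    fix k
    have "(\<lambda>z. \<lambda>j\<in>{..<p}. z (j, k)) \<in> measurable (std_gaussian ({..<p} \<times> {k})) (PiM {..<p} (\<lambda>_. borel))"
      by (rule measurable_restrict) (auto intro!: measurable_component_singleton simp: measurable_cong_sets[OF sets_std_gaussian refl])
    then show "gaussian_row p m l k \<in> measurable (std_gaussian ({..<p} \<times> {k})) (PiM {..<p} (\<lambda>_. borel))"
      unfolding gaussian_row_def[abs_def] by (rule measurable_compose[OF _ measurable_triangular_affine])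
  qed
  also have "(\<lambda>k z. gaussian_row p m l k (restrict (\<lambda>i. z i) ({..<p} \<times> {k}))) = gaussian_row p m l"
    by (auto simp: gaussian_row_def fun_eq_iff triangular_affine_def)
  finally show ?thesis .
qed

lemma gaussian_row_distr:
  fixes K :: "'k set"
  assumes k: "k \<in> K"
  shows "distr (std_gaussian ({..<p} \<times> K)) (PiM {..<p} (\<lambda>_. borel)) (gaussian_row p m l k)
    = distr (std_gaussian {..<p}) (PiM {..<p} (\<lambda>_. borel)) (triangular_affine p m l)"
proof -
  have m: "(\<lambda>z. \<lambda>j\<in>{..<p}. z (j, k)) \<in> measurable (std_gaussian ({..<p} \<times> K)) (std_gaussian {..<p})"
    by (rule measurable_restrict) (use k in \<open>auto intro!: measurable_component_singleton\<close>)
  have t: "triangular_affine p m l \<in> measurable (std_gaussian {..<p}) (PiM {..<p} (\<lambda>_. borel))"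
    by measurable
  have "std_gaussian {..<p} = distr (std_gaussian ({..<p} \<times> K)) (std_gaussian {..<p}) (\<lambda>z. \<lambda>j\<in>{..<p}. z (j, k))"
    by (rule distr_PiM_reindex[where f = "\<lambda>j. (j, k)", symmetric]) (use k in \<open>auto simp: inj_on_def prob_space_std_normal\<close>)
  then show ?thesis
    using distr_distr[OF t m] by (simp add: comp_def gaussian_row_def[abs_def])
qed

lemma sample_joint_distr:
  fixes X :: "'k \<Rightarrow> 'a \<Rightarrow> nat \<Rightarrow> real"
  assumes M: "prob_space M" and K: "finite K" "K \<noteq> {}" and p: "p \<ge> 1"
    and indep: "prob_space.indep_vars M (\<lambda>_. PiM {..<p} (\<lambda>_. borel)) X K"
    and law: "\<And>k. k \<in> K \<Longrightarrow> distr M (PiM {..<p} (\<lambda>_. borel)) (X k) = distr (std_gaussian {..<p}) (PiM {..<p} (\<lambda>_. borel)) (triangular_affine p m l)"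
  shows "distr M (PiM K (\<lambda>_. PiM {..<p} (\<lambda>_. borel))) (\<lambda>\<omega>. \<lambda>k\<in>K. X k \<omega>)
    = distr (std_gaussian ({..<p} \<times> K)) (PiM K (\<lambda>_. PiM {..<p} (\<lambda>_. borel))) (\<lambda>z. \<lambda>k\<in>K. gaussian_row p m l k z)"
proof -
  interpret M: prob_space M by fact
  interpret G: prob_space "std_gaussian ({..<p} \<times> K)" by (rule prob_space_std_gaussian)
  note ind = gaussian_rows_indep[OF K p, of m l]
  have "distr M (PiM K (\<lambda>_. PiM {..<p} (\<lambda>_. borel))) (\<lambda>\<omega>. \<lambda>k\<in>K. X k \<omega>) = PiM K (\<lambda>k. distr M (PiM {..<p} (\<lambda>_. borel)) (X k))"
    using indep M.indep_vars_iff_distr_eq_PiM'[OF K(2), where M' = "\<lambda>_. PiM {..<p} (\<lambda>_. borel)" and X = X]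
    by (simp add: M.indep_vars_def)
  also have "\<dots> = PiM K (\<lambda>k. distr (std_gaussian ({..<p} \<times> K)) (PiM {..<p} (\<lambda>_. borel)) (gaussian_row p m l k))"
    by (rule PiM_cong) (simp_all add: law gaussian_row_distr)
  also have "\<dots> = distr (std_gaussian ({..<p} \<times> K)) (PiM K (\<lambda>_. PiM {..<p} (\<lambda>_. borel))) (\<lambda>z. \<lambda>k\<in>K. gaussian_row p m l k z)"
    using ind G.indep_vars_iff_distr_eq_PiM'[OF K(2), where M' = "\<lambda>_. PiM {..<p} (\<lambda>_. borel)" and X = "gaussian_row p m l"]
    by (simp add: G.indep_vars_def)
  finally show ?thesis .
qed

section \<open>The log-determinant of the sample covariance\<close>

lemma sample_covariance_cong:
  assumes "\<And>k i. k \<in> {1..n+1} \<Longrightarrow> i < p \<Longrightarrow> x k i = y k i"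
  shows "sample_covariance n p x = sample_covariance n p y"
proof -
  have m: "sample_mean n x i = sample_mean n y i" if "i < p" for i
    unfolding sample_mean_def using assms that by (intro arg_cong2[where f = "(/)"] sum.cong) auto
  show ?thesis unfolding sample_covariance_def
    by (intro cong_mat refl) (auto simp: m assms intro!: sum.cong)
qed

text \<open>
  The deviations from the mean are the images under \<open>L\<close> of the centered columns, so the sample covariance
  is \<open>(1 / n) L G L\<^sup>T\<close> with the centered Gram matrix \<open>G\<close>; the shift \<open>m\<close> drops out.
\<close>

lemma det_sample_covariance_gaussian_rows:
  fixes l :: "nat \<Rightarrow> nat \<Rightarrow> real" and z :: "nat \<times> nat \<Rightarrow> real"
  assumes l: "\<And>i j. i < j \<Longrightarrow> l i j = 0"
  shows "det (sample_covariance n p (\<lambda>k. gaussian_row p m l k z))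
     = (\<Prod>i<p. l i i)^2 * gram_det {1..n+1} p z / real n ^ p"
proof -
  define K where "K = {1..n+1}"
  define L where "L = mat p p (\<lambda>(i, j). l i j)"
  define G where "G = gram_mat K p (centered K z)"
  have K: "card K = n + 1" by (simp add: K_def)
  have L: "L \<in> carrier_mat p p" and G: "G \<in> carrier_mat p p" by (simp_all add: L_def G_def gram_mat_def)
  have W: "gaussian_row p m l k z i = m i + (\<Sum>j<p. l i j * z (j, k))" if "i < p" for i k
    using that sum_lower_triangular[where l = l and i = i and p = p and z = "\<lambda>j. z (j, k)", OF l]
    by (simp add: gaussian_row_def triangular_affine_def)
  have mean: "sample_mean n (\<lambda>k. gaussian_row p m l k z) i = m i + (\<Sum>j<p. l i j * ((\<Sum>k\<in>K. z (j, k)) / real (card K)))" if "i < p" for i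
  proof -
    have "(\<Sum>k\<in>K. gaussian_row p m l k z i) = real (n + 1) * m i + (\<Sum>j<p. l i j * (\<Sum>k\<in>K. z (j, k)))"
      using that by (simp add: W sum.distrib K, subst sum.swap) (simp add: sum_distrib_left)
    moreover have "(\<Sum>j<p. l i j * (\<Sum>k\<in>K. z (j, k))) / real (n + 1) = (\<Sum>j<p. l i j * ((\<Sum>k\<in>K. z (j, k)) / real (n + 1)))"
      by (subst sum_divide_distrib) simp
    moreover have "real (n + 1) * m i / real (n + 1) = m i" by (rule nonzero_mult_div_cancel_left) simp
    ultimately show ?thesis
      unfolding sample_mean_def K_def[symmetric] K by (simp only: add_divide_distrib)
  qed
  have dev: "gaussian_row p m l k z i - sample_mean n (\<lambda>k. gaussian_row p m l k z) i = (\<Sum>j<p. l i j * centered K z j k)" if "i < p" for i k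
    using that by (simp add: W mean centered_def right_diff_distrib sum_subtractf)
  have "sample_covariance n p (\<lambda>k. gaussian_row p m l k z) = (1 / real n) \<cdot>\<^sub>m (L * (G * transpose_mat L))"
  proof (rule eq_matI)
    fix i j assume "i < dim_row ((1 / real n) \<cdot>\<^sub>m (L * (G * transpose_mat L)))" "j < dim_col ((1 / real n) \<cdot>\<^sub>m (L * (G * transpose_mat L)))"
    then have ij: "i < p" "j < p" by (simp_all add: L_def)
    have "(L * (G * transpose_mat L)) $$ (i, j) = (\<Sum>a<p. l i a * (\<Sum>b<p. (\<Sum>k\<in>K. centered K z a k * centered K z b k) * l j b))"
      using ij by (simp add: L_def G_def gram_mat_def scalar_prod_def lessThan_atLeast0)
    also have "\<dots> = (\<Sum>a<p. \<Sum>b<p. \<Sum>k\<in>K. (l i a * centered K z a k) * (l j b * centered K z b k))"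
      by (simp add: sum_distrib_left sum_distrib_right mult_ac)
    also have "\<dots> = (\<Sum>k\<in>K. \<Sum>a<p. \<Sum>b<p. (l i a * centered K z a k) * (l j b * centered K z b k))"
    proof -
      have "(\<Sum>a<p. \<Sum>b<p. \<Sum>k\<in>K. f a b k) = (\<Sum>a<p. \<Sum>k\<in>K. \<Sum>b<p. f a b k)" for f :: "nat \<Rightarrow> nat \<Rightarrow> nat \<Rightarrow> real"
        by (intro sum.cong refl sum.swap)
      then show ?thesis using sum.swap[of "\<lambda>a k. \<Sum>b<p. (l i a * centered K z a k) * (l j b * centered K z b k)" K "{..<p}"] by simp
    qed
    also have "\<dots> = (\<Sum>k\<in>K. (\<Sum>a<p. l i a * centered K z a k) * (\<Sum>b<p. l j b * centered K z b k))"
      by (simp add: sum_product)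
    finally have e: "(L * (G * transpose_mat L)) $$ (i, j) = (\<Sum>k\<in>K. (\<Sum>a<p. l i a * centered K z a k) * (\<Sum>b<p. l j b * centered K z b k))" .
    have "((1 / real n) \<cdot>\<^sub>m (L * (G * transpose_mat L))) $$ (i, j) = (1 / real n) * (L * (G * transpose_mat L)) $$ (i, j)"
      by (rule index_smult_mat(1)) (use ij in \<open>simp_all add: L_def\<close>)
    moreover have "sample_covariance n p (\<lambda>k. gaussian_row p m l k z) $$ (i, j)
        = (1 / real n) * (\<Sum>k\<in>K. (\<Sum>a<p. l i a * centered K z a k) * (\<Sum>b<p. l j b * centered K z b k))"
      unfolding sample_covariance_def K_def[symmetric] using ij by (simp add: dev)
    ultimately show "sample_covariance n p (\<lambda>k. gaussian_row p m l k z) $$ (i, j) = ((1 / real n) \<cdot>\<^sub>m (L * (G * transpose_mat L))) $$ (i, j)"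
      by (simp only: e)
  qed (simp_all add: sample_covariance_def L_def)
  moreover have "det (L * (G * transpose_mat L)) = (\<Prod>i<p. l i i)^2 * det G"
  proof -
    have LT: "transpose_mat L \<in> carrier_mat p p" using L by simp
    have "det (L * (G * transpose_mat L)) = det L * (det G * det L)"
      using det_mult[OF L mult_carrier_mat[OF G LT]] det_mult[OF G LT] det_transpose[OF L] by simp
    moreover have "det L = (\<Prod>i<p. l i i)" unfolding L_def by (rule det_lower_triangular_fun) (use l in auto)
    ultimately show ?thesis by (simp add: power2_eq_square)
  qed
  ultimately show ?thesis
    using L by (simp add: gram_det_def G_def K_def power_divide)
qed

text \<open>
  The sample and the array of rows \<open>\<mu> + L Z\<^sub>k\<close> have the same joint law, so the
  characteristic function may be computed on the array, where the log-determinant is almost surely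
  that of the Gram determinant plus constants.
\<close>

lemma log_det_char:
  fixes X :: "nat \<Rightarrow> 'a \<Rightarrow> nat \<Rightarrow> real" and c \<sigma> t :: real
  assumes M: "prob_space M" and p: "1 \<le> p" "p \<le> n" and \<mu>: "\<mu> \<in> carrier_vec p" and \<Sigma>: "positive_definite_mat p \<Sigma>"
    and indep: "prob_space.indep_vars M (\<lambda>_. PiM {..<p} (\<lambda>_. borel)) X {1..n+1}"
    and normal: "\<And>k. k \<in> {1..n+1} \<Longrightarrow> multivariate_normal_distributed M p (X k) \<mu> \<Sigma>"
  defines "S \<equiv> \<lambda>x. (ln (det (sample_covariance n p x)) - c - ln (det \<Sigma>)) / \<sigma>"
  shows "(\<lambda>\<omega>. S (\<lambda>k. X k \<omega>)) \<in> borel_measurable M"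
    and "char (distr M borel (\<lambda>\<omega>. S (\<lambda>k. X k \<omega>))) t
      = iexp (- (t / \<sigma> * (c + real p * ln (real n)))) *
        (\<Prod>j<p. iexp (t / \<sigma> * ln 2) * (Gamma (Complex (real (n - j) / 2) (t / \<sigma>)) / Gamma (of_real (real (n - j) / 2))))"
proof -
  interpret M: prob_space M by fact
  obtain l where l: "\<And>i. i < p \<Longrightarrow> l i i > 0" "\<And>i j. i < j \<Longrightarrow> l i j = 0"
    and \<Sigma>l: "\<Sigma> = mat p p (\<lambda>(i, j). l i j) * transpose_mat (mat p p (\<lambda>(i, j). l i j))"
    using positive_definite_cholesky[OF \<Sigma>] by blast
  define K where "K = {1..n+1}"
  have K: "finite K" "K \<noteq> {}" "card K = n + 1" by (auto simp: K_def)
  define P where "P = std_gaussian ({..<p} \<times> K)"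
  define m where "m = (\<lambda>i. \<mu> $ i)"
  define W where "W z k = gaussian_row p m l k z" for z :: "nat \<times> nat \<Rightarrow> real" and k
  let ?B = "PiM K (\<lambda>_. PiM {..<p} (\<lambda>_. borel :: real measure))"
  have law: "distr M (PiM {..<p} (\<lambda>_. borel)) (X k) = distr (std_gaussian {..<p}) (PiM {..<p} (\<lambda>_. borel)) (triangular_affine p m l)" if "k \<in> K" for k
    unfolding m_def using that normal[of k] by (intro multivariate_normal_distr[OF _ l \<Sigma>l \<mu>]) (auto simp: K_def)
  have joint: "distr M ?B (\<lambda>\<omega>. \<lambda>k\<in>K. X k \<omega>) = distr P ?B (\<lambda>z. \<lambda>k\<in>K. W z k)"
    unfolding P_def W_def by (rule sample_joint_distr[OF M K(1,2) p(1) indep[folded K_def] law])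
  have S_restrict: "S (\<lambda>k\<in>K. x k) = S x" for x
    unfolding S_def by (subst sample_covariance_cong[of n p "\<lambda>k\<in>K. x k" x]) (auto simp: K_def)
  have S[measurable]: "S \<in> borel_measurable ?B"
  proof -
    have c[measurable]: "(\<lambda>x. x k i) \<in> borel_measurable ?B" if "k \<in> {1..n+1}" "i < p" for k i
      using measurable_compose[OF measurable_component_singleton[of k K] measurable_component_singleton[of i "{..<p}"]] that
      by (auto simp: K_def)
    have "(\<lambda>x. det (sample_covariance n p x)) \<in> borel_measurable ?B"
      unfolding sample_covariance_def sample_mean_def
      by (intro measurable_det borel_measurable_times borel_measurable_const borel_measurable_sum borel_measurable_diff borel_measurable_divide c) auto
    then show ?thesis unfolding S_def by measurable
  qed
  have Xm: "(\<lambda>\<omega>. \<lambda>k\<in>K. X k \<omega>) \<in> measurable M ?B"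
    using indep by (intro measurable_restrict) (auto simp: M.indep_vars_def K_def)
  have Wm: "(\<lambda>z. \<lambda>k\<in>K. W z k) \<in> measurable P ?B"
  proof (rule measurable_restrict)
    interpret prob_space P unfolding P_def by (rule prob_space_std_gaussian)
    fix k assume "k \<in> K"
    then show "(\<lambda>z. W z k) \<in> measurable P (PiM {..<p} (\<lambda>_. borel))"
      using gaussian_rows_indep[OF K(1,2) p(1), of m l, folded P_def] unfolding W_def by (auto simp: indep_vars_def)
  qed
  have "(\<lambda>\<omega>. S (\<lambda>k\<in>K. X k \<omega>)) \<in> borel_measurable M" by (rule measurable_compose[OF Xm S])
  then show SX: "(\<lambda>\<omega>. S (\<lambda>k. X k \<omega>)) \<in> borel_measurable M" by (simp add: S_restrict)
  have SW: "(\<lambda>z. S (W z)) \<in> borel_measurable P"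
    using measurable_compose[OF Wm S] by (simp add: S_restrict)
  have "distr M borel (\<lambda>\<omega>. S (\<lambda>k. X k \<omega>)) = distr (distr M ?B (\<lambda>\<omega>. \<lambda>k\<in>K. X k \<omega>)) borel S"
    using distr_distr[OF S Xm] by (simp add: comp_def S_restrict)
  also have "\<dots> = distr P borel (\<lambda>z. S (W z))"
    unfolding joint using distr_distr[OF S Wm] by (simp add: comp_def S_restrict)
  finally have "char (distr M borel (\<lambda>\<omega>. S (\<lambda>k. X k \<omega>))) t = (\<integral> z. iexp (t * S (W z)) \<partial>P)"
    unfolding char_def using SW by (simp add: integral_distr)
  also have "\<dots> = (\<integral> z. iexp (- (t / \<sigma> * (c + real p * ln (real n)))) * iexp (t / \<sigma> * ln (gram_det K p z)) \<partial>P)"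
  proof (rule integral_cong_AE)
    have d: "det \<Sigma> = (\<Prod>i<p. l i i)^2" "(\<Prod>i<p. l i i) > 0"
    proof -
      have "det (mat p p (\<lambda>(i, j). l i j)) = (\<Prod>i<p. l i i)" by (rule det_lower_triangular_fun) (use l in auto)
      then show "det \<Sigma> = (\<Prod>i<p. l i i)^2" unfolding \<Sigma>l
        by (subst det_mult[of _ p]) (simp_all add: det_transpose[of _ p] power2_eq_square)
      show "(\<Prod>i<p. l i i) > 0" using l(1) by (intro prod_pos) auto
    qed
    have "det \<Sigma> > 0" unfolding d(1) using d(2) by (rule zero_less_power)
    have "AE z in P. \<forall>q\<le>p. gram_det K q z > 0"
      unfolding P_def using p by (intro gram_det_positive) (auto simp: K)
    then show "AE z in P. iexp (t * S (W z)) = iexp (- (t / \<sigma> * (c + real p * ln (real n)))) * iexp (t / \<sigma> * ln (gram_det K p z))"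
    proof eventually_elim
      case (elim z)
      then have g: "gram_det K p z > 0" by simp
      have "det (sample_covariance n p (W z)) = det \<Sigma> * gram_det K p z / real n ^ p"
        using det_sample_covariance_gaussian_rows[where l = l, OF l(2), of n p m z] p unfolding W_def d(1) by (simp add: K_def)
      then have v: "ln (det (sample_covariance n p (W z))) = ln (det \<Sigma>) + ln (gram_det K p z) - real p * ln (real n)"
        using g \<open>det \<Sigma> > 0\<close> p by (simp add: ln_div ln_mult_pos ln_realpow)
      have "t * S (W z) = - (t / \<sigma> * (c + real p * ln (real n))) + t / \<sigma> * ln (gram_det K p z)"
        unfolding S_def v by (simp add: diff_divide_distrib add_divide_distrib algebra_simps)
      then show ?case by (simp only: exp_add[symmetric] of_real_add distrib_left)
    qed
    have [measurable]: "gram_det K p \<in> borel_measurable P"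
      unfolding P_def measurable_cong_sets[OF sets_std_gaussian refl] by (rule measurable_gram_det) auto
    show "(\<lambda>z. iexp (- (t / \<sigma> * (c + real p * ln (real n)))) * iexp (t / \<sigma> * ln (gram_det K p z))) \<in> borel_measurable P"
      by measurable
    show "(\<lambda>z. iexp (t * S (W z))) \<in> borel_measurable P" using SW by measurable
  qed
  also have "\<dots> = iexp (- (t / \<sigma> * (c + real p * ln (real n)))) * (\<integral> z. iexp (t / \<sigma> * ln (gram_det K p z)) \<partial>P)"
    by simp
  also have "(\<integral> z. iexp (t / \<sigma> * ln (gram_det K p z)) \<partial>P)
     = (\<Prod>j<p. iexp (t / \<sigma> * ln 2) * (Gamma (Complex (real (card K - Suc j) / 2) (t / \<sigma>)) / Gamma (of_real (real (card K - Suc j) / 2))))"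
    unfolding P_def by (rule gram_det_log_char[OF K(1)]) (use p K in auto)
  also have "\<dots> = (\<Prod>j<p. iexp (t / \<sigma> * ln 2) * (Gamma (Complex (real (n - j) / 2) (t / \<sigma>)) / Gamma (of_real (real (n - j) / 2))))"
    by (simp add: K)
  finally show "char (distr M borel (\<lambda>\<omega>. S (\<lambda>k. X k \<omega>))) t = iexp (- (t / \<sigma> * (c + real p * ln (real n)))) *
        (\<Prod>j<p. iexp (t / \<sigma> * ln 2) * (Gamma (Complex (real (n - j) / 2) (t / \<sigma>)) / Gamma (of_real (real (n - j) / 2))))" .
qed

theorem corollary2:
  fixes M :: "nat \<Rightarrow> 'a measure"
    and p :: "nat \<Rightarrow> nat"
    and \<mu> :: "nat \<Rightarrow> real vec"
    and \<Sigma> :: "nat \<Rightarrow> real mat"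
    and X :: "nat \<Rightarrow> nat \<Rightarrow> 'a \<Rightarrow> nat \<Rightarrow> real"
    and r :: real
  assumes prob: "\<And>n. n \<ge> 1 \<Longrightarrow> prob_space (M n)"
    and p_pos: "\<And>n. n \<ge> 1 \<Longrightarrow> 1 \<le> p n"
    and p_le: "\<And>n. n \<ge> 1 \<Longrightarrow> p n \<le> n"
    and mean: "\<And>n. n \<ge> 1 \<Longrightarrow> \<mu> n \<in> carrier_vec (p n)"
    and cov: "\<And>n. n \<ge> 1 \<Longrightarrow> positive_definite_mat (p n) (\<Sigma> n)"
    and indep: "\<And>n. n \<ge> 1 \<Longrightarrow>
      prob_space.indep_vars (M n) (\<lambda>_. PiM {..<p n} (\<lambda>_. borel)) (X n) {1..n+1}"
    and normal: "\<And>n k. n \<ge> 1 \<Longrightarrow> k \<in> {1..n+1} \<Longrightarrow>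
      multivariate_normal_distributed (M n) (p n) (X n k) (\<mu> n) (\<Sigma> n)"
    and r_bounds: "0 \<le> r" "r < 1"
    and ratio: "(\<lambda>n. real (p n) / real n) \<longlonglongrightarrow> r"
  shows "weak_conv_m
    (\<lambda>n. distr (M n) borel (\<lambda>\<omega>.
       (ln (det (sample_covariance n (p n) (\<lambda>k. X n k \<omega>)))
          - (\<Sum>k=1..p n. ln (1 - real k / real n))
          - ln (det (\<Sigma> n)))
       / sqrt (- 2 * ln (1 - real (p n) / real n))))
    std_normal_distribution" (is "weak_conv_m ?D _")
proof -
  define \<sigma> where "\<sigma> n = sqrt (- 2 * ln (1 - real (p n) / real n))" for n
  have dist: "real_distribution (?D n)" if n: "n \<ge> 1" for n
    by (intro prob_space.real_distribution_distr prob[OF n]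
      log_det_char(1)[OF prob[OF n] p_pos[OF n] p_le[OF n] mean[OF n] cov[OF n] indep[OF n]] normal[OF n])
  have ch: "char (?D n) t
      = iexp (- (t / \<sigma> n * ((\<Sum>k=1..p n. ln (1 - real k / real n)) + real (p n) * ln (real n)))) *
        (\<Prod>j<p n. iexp (t / \<sigma> n * ln 2) * (Gamma (Complex (real (n - j) / 2) (t / \<sigma> n)) / Gamma (of_real (real (n - j) / 2))))"
    (is "_ = ?f n t") if n: "n \<ge> 1" for n t
    unfolding \<sigma>_def
    by (rule log_det_char(2)[OF prob[OF n] p_pos[OF n] p_le[OF n] mean[OF n] cov[OF n] indep[OF n]]) (rule normal[OF n])
  \<comment> \<open>The index is shifted because the hypotheses say nothing about M 0, which need not be a probability space.\<close>
  have "weak_conv_m (\<lambda>n. ?D (Suc n)) std_normal_distribution"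
  proof (rule levy_continuity)
    show "real_distribution (?D (Suc n))" for n by (rule dist) simp
    show "real_distribution std_normal_distribution" by (rule real_dist_normal_dist)
    fix t :: real
    have "(\<lambda>n. char (?D n) t) \<longlonglongrightarrow> exp (- complex_of_real (t^2 / 2))"
    proof (rule Lim_transform_eventually)
      show "(\<lambda>n. ?f n t) \<longlonglongrightarrow> exp (- complex_of_real (t^2 / 2))"
        unfolding \<sigma>_def by (rule gamma_product_tendsto[OF _ r_bounds(2) ratio]) (rule p_pos)
      show "\<forall>\<^sub>F n in sequentially. ?f n t = char (?D n) t"
        using eventually_ge_at_top[of 1] by eventually_elim (rule ch[symmetric])
    qed
    then have "(\<lambda>n. char (?D (Suc n)) t) \<longlonglongrightarrow> exp (- complex_of_real (t^2 / 2))"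
      by (rule LIMSEQ_Suc)
    then show "(\<lambda>n. char (?D (Suc n)) t) \<longlonglongrightarrow> char std_normal_distribution t"
      by (simp add: char_std_normal_distribution exp_of_real[symmetric])
  qed
  then show ?thesis
    unfolding weak_conv_m_def weak_conv_def by (auto intro: LIMSEQ_imp_Suc)
qed

end
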